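(* Let $c\in\mathbb{R}_{\ge1}$ and $r\in\{2,3\}$. Let $G=\bigoplus_{i=1}^n\bigoplus_{j=1}^{n_i}C_{p_i^{e_{ij}}}$ be a finite abelian group, where $p_i>r$ ($1\le i\le n$) are distinct primes, with $p_1<\cdots<p_n<cp_1$ if $n>1$. Suppose that $K_1(G)=K_1^*(G)$ and $k(C_r\oplus G)=k^*(C_r\oplus G)$. Suppose that $p_1$ is large enough so that $$\frac{1}{r}+\frac{1}{p_1}K_1^*\left(\bigoplus_{j=1}^{n_1}C_{p_1^{e_{1j}}}\right)+\sum_{i=2}^n\sum_{j=1}^{n_i}\frac{(cp_1)^{e_{ij}}-1}{(cp_1)^{e_{ij}+1}-(cp_1)^{e_{ij}}}\ \ge\ \frac{\log_2\left(r\,c^{\sum_{i=2}^n\sum_{j=1}^{n_i}e_{ij}}\,p_1^{\sum_{i=1}^n\sum_{j=1}^{n_i}e_{ij}}\right)}{p_1}.\qquad( * )$$ Then $K_1(C_r\oplus G)=K_1^*(C_r\oplus G)$. Furthermore, if equality does not hold in $( * )$, then any UFIM $S$ over $(C_r\oplus G)\setminus\{0\}$ with $k(S)=K_1(C_r\oplus G)$ has a decomposition $S=S_r\sqcup S_G$ such that $S_r$ is a UFIM over $C_r\setminus\{0\}$ and $S_G$ is a UFIM over $G\setminus\{0\}$ (with $C_r$ and $G$ regarded as subgroups of $C_r\oplus G$).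
   Context: Groups are finite abelian, written additively; $C_n$ is the cyclic group of order $n$. An indexed multiset $S=\{g_1,\ldots,g_\ell\}$ over a set $X\subseteq G$ is a finite (possibly empty) indexed family of elements of $X$; for $I\subseteq[\ell]$ put $S(I)=\{g_i : i\in I\}$; submultisets of $S$ are the $S(I)$, and disjoint unions $\sqcup$ are taken with respect to indices. Put $\sigma(S)=\sum_{g\in S}g$ (with multiplicity), $\sigma(\emptyset)=0$. $S$ is zero-sum if $\sigma(S)=0$; minimal zero-sum if $\sigma(S)=0$ and $\sigma(S')\ne0$ for every $\emptyset\subsetneq S'\subsetneq S$; zero-sum free if $\sigma(S')\neq0$ for every $\emptyset\subsetneq S'\subseteq S$. An irreducible factorization of $S$ over $G\setminus\{0\}$ is a partition $[\ell]=\bigsqcup_{i=1}^m I_i$ into nonempty sets with each $S(I_i)$ minimal zero-sum; two factorizations are equivalent iff they are the same set of blocks $\{I_1,\ldots,I_m\}$. A unique factorization indexed multiset (UFIM) over $G\setminus\{0\}$ is a zero-sum indexed multiset over $G\setminus\{0\}$ with exactly one irreducible factorization up to equivalence. The cross number of $S$ is $k(S)=\sum_{g\in S}\frac1{\mathrm{ord}(g)}$ (with multiplicity; $k(\emptyset)=0$). Put $K_1(G)=\max\{k(S): S\text{ is a UFIM over }G\setminus\{0\}\}$ and $k(G)=\max\{k(S): S\text{ is a zero-sum free indexed multiset over }G\setminus\{0\}\}$. For $G=\bigoplus_{i=1}^n\bigoplus_{j=1}^{n_i}C_{p_i^{e_{ij}}}$ with distinct primes $p_i$ and $e_{ij}\ge1$,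 put $K_1^*(G)=\sum_{i=1}^n\sum_{j=1}^{n_i}\frac{p_i^{e_{ij}}-1}{p_i^{e_{ij}}-p_i^{e_{ij}-1}}$ and $k^*(G)=\sum_{i=1}^n\sum_{j=1}^{n_i}\frac{p_i^{e_{ij}}-1}{p_i^{e_{ij}}}$. *)

theory Defs
  imports Complex_Main "HOL-Computational_Algebra.Primes" "HOL-Algebra.Product_Groups" "HOL-Algebra.Multiplicative_Group" "HOL-Library.Disjoint_Sets"
begin

text \<open>
  Groups are written multiplicatively, as in the library: the zero of the additive
  notation is \<open>\<one>\<^bsub>G\<^esub>\<close> and the sum of an indexed multiset is its product.
  An indexed multiset is a finite index set \<open>I :: nat set\<close> together with a family
  \<open>g :: nat \<Rightarrow> 'a\<close>, of which only the values on \<open>I\<close> matter. Its submultisets are given by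
  the same \<open>g\<close> on subsets of \<open>I\<close>, so \<open>g\<close> precedes \<open>I\<close> in the argument lists below.
\<close>

definition indexed_multiset :: "'a set \<Rightarrow> (nat \<Rightarrow> 'a) \<Rightarrow> nat set \<Rightarrow> bool" where
  "indexed_multiset X g I \<longleftrightarrow> finite I \<and> g \<in> I \<rightarrow> X"

definition zero_sum :: "('a, 'b) monoid_scheme \<Rightarrow> (nat \<Rightarrow> 'a) \<Rightarrow> nat set \<Rightarrow> bool" where
  "zero_sum G g I \<longleftrightarrow> finprod G g I = \<one>\<^bsub>G\<^esub>"

definition minimal_zero_sum :: "('a, 'b) monoid_scheme \<Rightarrow> (nat \<Rightarrow> 'a) \<Rightarrow> nat set \<Rightarrow> bool" where
  "minimal_zero_sum G g I \<longleftrightarrow>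
     zero_sum G g I \<and> (\<forall>J. J \<noteq> {} \<and> J \<subset> I \<longrightarrow> \<not> zero_sum G g J)"

definition zero_sum_free :: "('a, 'b) monoid_scheme \<Rightarrow> (nat \<Rightarrow> 'a) \<Rightarrow> nat set \<Rightarrow> bool" where
  "zero_sum_free G g I \<longleftrightarrow> (\<forall>J. J \<noteq> {} \<and> J \<subseteq> I \<longrightarrow> \<not> zero_sum G g J)"

definition irreducible_factorization ::
    "('a, 'b) monoid_scheme \<Rightarrow> (nat \<Rightarrow> 'a) \<Rightarrow> nat set \<Rightarrow> nat set set \<Rightarrow> bool" where
  "irreducible_factorization G g I P \<longleftrightarrow>
     partition_on I P \<and> (\<forall>B\<in>P. minimal_zero_sum G g B)"

text \<open>
  The set \<open>X\<close> is \<open>carrier G - {\<one>\<^bsub>G\<^esub>}\<close>, or the set of non-identity elements of a subgroup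
  of \<open>G\<close> for a UFIM over that subgroup. Equivalent factorizations are equal as sets of blocks.
\<close>

definition ufim :: "('a, 'b) monoid_scheme \<Rightarrow> 'a set \<Rightarrow> (nat \<Rightarrow> 'a) \<Rightarrow> nat set \<Rightarrow> bool" where
  "ufim G X g I \<longleftrightarrow>
     indexed_multiset X g I \<and> zero_sum G g I \<and> (\<exists>!P. irreducible_factorization G g I P)"

definition cross_number :: "('a, 'b) monoid_scheme \<Rightarrow> (nat \<Rightarrow> 'a) \<Rightarrow> nat set \<Rightarrow> real" where
  "cross_number G g I = (\<Sum>i\<in>I. 1 / real (group.ord G (g i)))"

definition K1 :: "('a, 'b) monoid_scheme \<Rightarrow> real" where
  "K1 G = Max {cross_number G g I | g I. ufim G (carrier G - {\<one>\<^bsub>G\<^esub>}) g I}"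

definition little_k :: "('a, 'b) monoid_scheme \<Rightarrow> real" where
  "little_k G = Max {cross_number G g I | g I.
     indexed_multiset (carrier G - {\<one>\<^bsub>G\<^esub>}) g I \<and> zero_sum_free G g I}"

text \<open>
  The data \<open>A\<close>, \<open>p\<close>, \<open>N\<close>, \<open>e\<close> describe the direct sum, over \<open>i \<in> A\<close> and \<open>1 \<le> j \<le> N i\<close>, of the
  cyclic groups of order \<open>p i ^ e i j\<close>. The values \<open>K1_star\<close> and \<open>k_star\<close> are computed
  from these data.
\<close>

definition cyclic_sum ::
    "nat set \<Rightarrow> (nat \<Rightarrow> nat) \<Rightarrow> (nat \<Rightarrow> nat) \<Rightarrow> (nat \<Rightarrow> nat \<Rightarrow> nat) \<Rightarrow> (nat \<times> nat \<Rightarrow> int) monoid" where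
  "cyclic_sum A p N e =
     sum_group (SIGMA i:A. {1..N i}) (\<lambda>(i, j). integer_mod_group (p i ^ e i j))"

definition K1_star ::
    "nat set \<Rightarrow> (nat \<Rightarrow> nat) \<Rightarrow> (nat \<Rightarrow> nat) \<Rightarrow> (nat \<Rightarrow> nat \<Rightarrow> nat) \<Rightarrow> real" where
  "K1_star A p N e = (\<Sum>i\<in>A. \<Sum>j=1..N i.
     (real (p i) ^ e i j - 1) / (real (p i) ^ e i j - real (p i) ^ (e i j - 1)))"

definition k_star ::
    "nat set \<Rightarrow> (nat \<Rightarrow> nat) \<Rightarrow> (nat \<Rightarrow> nat) \<Rightarrow> (nat \<Rightarrow> nat \<Rightarrow> nat) \<Rightarrow> real" where
  "k_star A p N e = (\<Sum>i\<in>A. \<Sum>j=1..N i. (real (p i) ^ e i j - 1) / real (p i) ^ e i j)"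

text \<open>
  If \<open>A = {1..n}\<close> describes \<open>G\<close>, then \<open>C\<^sub>r \<oplus> G\<close> is described by \<open>{0..n}\<close> and the following
  data, in which the index \<open>0\<close> carries the single summand \<open>C\<^sub>r\<close>; here \<open>r\<close> is a prime
  different from all \<open>p i\<close>.
\<close>

definition adjoin_p :: "nat \<Rightarrow> (nat \<Rightarrow> nat) \<Rightarrow> nat \<Rightarrow> nat" where
  "adjoin_p r p = p(0 := r)"

definition adjoin_N :: "(nat \<Rightarrow> nat) \<Rightarrow> nat \<Rightarrow> nat" where
  "adjoin_N N = N(0 := 1)"

definition adjoin_e :: "(nat \<Rightarrow> nat \<Rightarrow> nat) \<Rightarrow> nat \<Rightarrow> nat \<Rightarrow> nat" where
  "adjoin_e e = e(0 := (\<lambda>_. 1))"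

end

theory Submission
  imports Defs
begin

text \<open>
  In a UFIM the zero-sum submultisets are exactly the unions of blocks. Hence removing one element
  from each block leaves a zero-sum free multiset, and the subset sums of a transversal of the blocks
  are distinct, so that there are at most \<open>log\<^sub>2 |C\<^sub>r \<oplus> G|\<close> blocks.

  Let \<open>S\<close> be a UFIM over \<open>C\<^sub>r \<oplus> G\<close>. If no block lies in \<open>C\<^sub>r\<close>, then each block contains an
  element of order at least \<open>p\<^sub>1\<close>, and removing these elements gives
  \<open>k(S) \<le> k(C\<^sub>r \<oplus> G) + log\<^sub>2 |C\<^sub>r \<oplus> G| / p\<^sub>1 \<le> k\<^sup>*(C\<^sub>r \<oplus> G) + R \<le> k\<^sup>*(C\<^sub>r \<oplus> G) + L
  \<le> K\<^sub>1\<^sup>*(C\<^sub>r \<oplus> G)\<close>, where \<open>L\<close> and \<open>R\<close> are the two sides of the hypothesis on \<open>p\<^sub>1\<close>.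

  If some block \<open>T\<close> lies in \<open>C\<^sub>r\<close>, then, as \<open>r \<le> 3\<close>, the proper nonempty subsums of \<open>T\<close> exhaust
  \<open>C\<^sub>r - {0}\<close>, so a submultiset of \<open>S - T\<close> with sum in \<open>C\<^sub>r\<close> has sum \<open>0\<close>. Thus the projection of
  \<open>S - T\<close> to \<open>G\<close> is again a UFIM, and \<open>k(S) \<le> 1 + K\<^sub>1(G)\<close>, with equality only if \<open>S - T\<close> lies in \<open>G\<close>.
\<close>

subsection \<open>Unions of blocks\<close>

text \<open>For indexed multisets this turns out to be equivalent to unique factorization, with
  \<open>P\<close> the factorization. Describing all zero-sum \<open>J\<close> at once lets the
  property pass to submultisets and through projections without a fresh argument about
  irreducibility.\<close>

definition zero_sum_blocks ::
    "('a, 'b) monoid_scheme \<Rightarrow> (nat \<Rightarrow> 'a) \<Rightarrow> nat set \<Rightarrow> nat set set \<Rightarrow> bool" where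
  "zero_sum_blocks G g I P \<longleftrightarrow>
     partition_on I P \<and> (\<forall>J\<subseteq>I. zero_sum G g J \<longleftrightarrow> (\<forall>B\<in>P. B \<subseteq> J \<or> B \<inter> J = {}))"

context comm_group
begin

lemma zero_sum_empty [simp]: "zero_sum G g {}"
  by (simp add: zero_sum_def)

lemma zero_sum_Un_iff:
  assumes "finite A" "finite B" "A \<inter> B = {}" "g \<in> A \<union> B \<rightarrow> carrier G" "zero_sum G g A"
  shows "zero_sum G g (A \<union> B) \<longleftrightarrow> zero_sum G g B"
  using assms by (auto simp: zero_sum_def finprod_Un_disjoint)

lemma zero_sum_Diff:
  assumes "finite I" "g \<in> I \<rightarrow> carrier G" "zero_sum G g I" "J \<subseteq> I" "zero_sum G g J"
  shows "zero_sum G g (I - J)"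
proof -
  have "J \<union> (I - J) = I" using assms by auto
  moreover have "finite J" "finite (I - J)" using assms finite_subset by auto
  ultimately show ?thesis
    using zero_sum_Un_iff[of J "I - J" g] assms by auto
qed

lemma zero_sum_Union:
  assumes "finite I" "partition_on I P" "g \<in> I \<rightarrow> carrier G"
    and "\<And>B. B \<in> P \<Longrightarrow> zero_sum G g B" "Q \<subseteq> P"
  shows "zero_sum G g (\<Union>Q)"
proof -
  have U: "\<Union>P = I" using assms(2) by (simp add: partition_on_def)
  have P: "finite P" using finite_elements assms by blast
  have "finprod G g (\<Union>Q) = finprod G (finprod G g) Q"
  proof (rule finprod_Union_disjoint)
    show "finite Q" using P assms(5) finite_subset by blast
    show "finite A \<and> (\<forall>x\<in>A. g x \<in> carrier G)" if "A \<in> Q" for A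
    proof -
      have "A \<subseteq> I" using that assms(5) U by auto
      then show ?thesis using assms(1,3) finite_subset by auto
    qed
    show "pairwise disjnt Q"
      using assms(2,5) by (auto simp: partition_on_def intro: pairwise_subset)
  qed
  also have "\<dots> = \<one>"
    by (rule finprod_one_eqI) (use assms in \<open>auto simp: zero_sum_def\<close>)
  finally show ?thesis by (simp add: zero_sum_def)
qed

section \<open>Existence and uniqueness of factorizations\<close>

text \<open>An inclusion-minimal nonempty zero-sum subset is a block; its complement is again
  zero-sum and smaller, so induction factors it.\<close>

lemma ex_irreducible_factorization:
  assumes "finite I" "g \<in> I \<rightarrow> carrier G" "zero_sum G g I"
  shows "\<exists>P. irreducible_factorization G g I P"
  using assms
proof (induction I rule: finite_psubset_induct)
  case (psubset I)
  show ?case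
  proof (cases "I = {}")
    case True
    then show ?thesis by (auto simp: irreducible_factorization_def partition_on_empty)
  next
    case False
    define F where "F = {J. J \<subseteq> I \<and> J \<noteq> {} \<and> zero_sum G g J}"
    have "finite F" "F \<noteq> {}"
      using psubset False by (auto simp: F_def)
    then obtain B where B: "B \<in> F" "\<And>J. J \<in> F \<Longrightarrow> J \<subseteq> B \<Longrightarrow> J = B"
      using finite_has_minimal[of F] by metis
    have BI: "B \<subseteq> I" "B \<noteq> {}" "zero_sum G g B" using B by (auto simp: F_def)
    have min: "minimal_zero_sum G g B"
      using B by (auto simp: F_def minimal_zero_sum_def)
    have "zero_sum G g (I - B)"
      using zero_sum_Diff psubset BI by blast
    then obtain P where P: "irreducible_factorization G g (I - B) P"
      using psubset.IH[of "I - B"] psubset.prems BI by blast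
    have "disjnt B (\<Union>P)"
      using P by (auto simp: irreducible_factorization_def partition_on_def disjnt_def)
    then have "irreducible_factorization G g I (insert B P)"
      using P min BI by (auto simp: irreducible_factorization_def partition_on_insert)
    then show ?thesis by blast
  qed
qed

text \<open>A block of any other factorization is zero-sum, so it contains every block of
  \<open>P\<close> that it meets, and by its own minimality it equals that block. Since both
  families cover \<open>I\<close>, they coincide.\<close>

lemma zero_sum_blocks_imp_ex1:
  assumes P: "zero_sum_blocks G g I P"
  shows "\<exists>!P. irreducible_factorization G g I P"
proof (rule ex1I[of _ P])
  have part: "partition_on I P"
    and iff: "\<And>J. J \<subseteq> I \<Longrightarrow> zero_sum G g J \<longleftrightarrow> (\<forall>B\<in>P. B \<subseteq> J \<or> B \<inter> J = {})"
    using P by (auto simp: zero_sum_blocks_def)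
  have disj: "B = C \<or> B \<inter> C = {}" if "B \<in> P" "C \<in> P" for B C
    using part that by (auto simp: partition_on_def disjoint_def)
  have sub: "B \<subseteq> I" "B \<noteq> {}" if "B \<in> P" for B
    using part that by (auto simp: partition_on_def)
  have blocks: "zero_sum G g B" if "B \<in> P" for B
    using iff[of B] disj sub that by blast
  show "irreducible_factorization G g I P"
    unfolding irreducible_factorization_def minimal_zero_sum_def
  proof (intro conjI ballI allI impI part blocks)
    fix B J assume B: "B \<in> P" and J: "J \<noteq> {} \<and> J \<subset> B"
    then show "\<not> zero_sum G g J"
      using iff[of J] sub[OF B] by blast
  qed
  fix P' assume P': "irreducible_factorization G g I P'"
  then have part': "partition_on I P'" and min: "\<And>B. B \<in> P' \<Longrightarrow> minimal_zero_sum G g B"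
    by (auto simp: irreducible_factorization_def)
  have "P' \<subseteq> P"
  proof
    fix B' assume B': "B' \<in> P'"
    have "B' \<subseteq> I" "B' \<noteq> {}" using part' B' by (auto simp: partition_on_def)
    then obtain x where "x \<in> B'" "x \<in> \<Union>P"
      using partition_onD1[OF part] by blast
    then obtain B where x: "x \<in> B'" "x \<in> B" "B \<in> P" by blast
    have "B \<subseteq> B'"
      using iff[OF \<open>B' \<subseteq> I\<close>] min[OF B'] x by (auto simp: minimal_zero_sum_def)
    then have "B = B'"
      using min[OF B'] blocks x by (auto simp: minimal_zero_sum_def)
    then show "B' \<in> P" using x by simp
  qed
  moreover have "P \<subseteq> P'"
  proof
    fix B assume B: "B \<in> P"
    then obtain x where "x \<in> B" "x \<in> I" using sub by fastforce
    then obtain B' where B': "x \<in> B'" "B' \<in> P'" using part' by (auto simp: partition_on_def)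
    then have "B' = B" using \<open>P' \<subseteq> P\<close> disj[OF B] \<open>x \<in> B\<close> by blast
    then show "B \<in> P'" using B' by simp
  qed
  ultimately show "P' = P" by blast
qed

text \<open>For zero-sum \<open>J\<close>, factorizations of \<open>J\<close> and of
  \<open>I - J\<close> combine to one of \<open>I\<close>. By uniqueness this is \<open>P\<close>,
  so every block of \<open>P\<close> lies on one side.\<close>

lemma ex1_imp_zero_sum_blocks:
  assumes "finite I" "g \<in> I \<rightarrow> carrier G" "zero_sum G g I"
    and "\<exists>!P. irreducible_factorization G g I P"
  shows "\<exists>P. zero_sum_blocks G g I P"
proof -
  obtain P where P: "irreducible_factorization G g I P"
    and uniq: "\<And>P'. irreducible_factorization G g I P' \<Longrightarrow> P' = P"
    using assms(4) by blast
  have part: "partition_on I P" and min: "\<And>B. B \<in> P \<Longrightarrow> zero_sum G g B"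
    using P by (auto simp: irreducible_factorization_def minimal_zero_sum_def)
  have "zero_sum_blocks G g I P"
    unfolding zero_sum_blocks_def
  proof (intro conjI part allI impI iffI ballI)
    fix J B assume J: "J \<subseteq> I" "zero_sum G g J" and B: "B \<in> P"
    have fin: "finite J" "g \<in> J \<rightarrow> carrier G" "g \<in> I - J \<rightarrow> carrier G"
      using assms J finite_subset by auto
    obtain P1 where P1: "irreducible_factorization G g J P1"
      using ex_irreducible_factorization[OF fin(1,2) J(2)] by blast
    obtain P2 where P2: "irreducible_factorization G g (I - J) P2"
      using ex_irreducible_factorization[OF _ fin(3) zero_sum_Diff[OF assms(1-3) J]] assms(1) by auto
    have "partition_on I (P1 \<union> P2)"
    proof (rule partition_onI)
      show "\<Union> (P1 \<union> P2) = I" "{} \<notin> P1 \<union> P2"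
        using P1 P2 J by (auto simp: irreducible_factorization_def partition_on_def)
      have U: "\<Union>P1 = J" "\<Union>P2 = I - J" and d: "disjoint P1" "disjoint P2"
        using P1 P2 by (auto simp: irreducible_factorization_def partition_on_def)
      show "disjnt p q" if "p \<in> P1 \<union> P2" "q \<in> P1 \<union> P2" "p \<noteq> q" for p q
        using that U d unfolding disjnt_def disjoint_def by blast
    qed
    then have "irreducible_factorization G g I (P1 \<union> P2)"
      using P1 P2 by (auto simp: irreducible_factorization_def)
    then have "P1 \<union> P2 = P" by (rule uniq)
    then show "B \<subseteq> J \<or> B \<inter> J = {}"
      using P1 P2 B by (auto simp: irreducible_factorization_def partition_on_def)
  next
    fix J assume J: "J \<subseteq> I" "\<forall>B\<in>P. B \<subseteq> J \<or> B \<inter> J = {}"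
    then have "J = \<Union>{B\<in>P. B \<subseteq> J}"
      using partition_onD1[OF part] by blast
    moreover have "zero_sum G g (\<Union>{B\<in>P. B \<subseteq> J})"
      by (rule zero_sum_Union[OF assms(1) part assms(2) min]) auto
    ultimately show "zero_sum G g J" by simp
  qed
  then show ?thesis ..
qed

text \<open>The set \<open>X\<close> stays general because the final decomposition speaks of UFIMs
  over two subgroups of the same product.\<close>

lemma ufim_iff:
  assumes "X \<subseteq> carrier G"
  shows "ufim G X g I \<longleftrightarrow> indexed_multiset X g I \<and> (\<exists>P. zero_sum_blocks G g I P)"
proof
  assume *: "ufim G X g I"
  then have "finite I" "g \<in> I \<rightarrow> carrier G"
    using assms by (auto simp: ufim_def indexed_multiset_def)
  then show "indexed_multiset X g I \<and> (\<exists>P. zero_sum_blocks G g I P)"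
    using * ex1_imp_zero_sum_blocks by (auto simp: ufim_def)
next
  assume *: "indexed_multiset X g I \<and> (\<exists>P. zero_sum_blocks G g I P)"
  then obtain P where P: "zero_sum_blocks G g I P" by blast
  then have "zero_sum G g I" by (auto simp: zero_sum_blocks_def partition_on_def)
  then show "ufim G X g I"
    using * zero_sum_blocks_imp_ex1[OF P] by (simp add: ufim_def)
qed

text \<open>Blocks meeting \<open>J\<close> lie inside it, so those inside \<open>J\<close>
  partition it. Applied to a block \<open>T\<close> and to \<open>I - T\<close>, this yields the two
  parts of the decomposition.\<close>

lemma zero_sum_blocks_subset:
  assumes P: "zero_sum_blocks G g I P" and J: "J \<subseteq> I" "zero_sum G g J"
  shows "zero_sum_blocks G g J {B\<in>P. B \<subseteq> J}"
proof -
  have part: "partition_on I P"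
    and iff: "\<And>J. J \<subseteq> I \<Longrightarrow> zero_sum G g J \<longleftrightarrow> (\<forall>B\<in>P. B \<subseteq> J \<or> B \<inter> J = {})"
    using P by (auto simp: zero_sum_blocks_def)
  have sat: "B \<subseteq> J \<or> B \<inter> J = {}" if "B \<in> P" for B
    using iff[OF J(1)] J(2) that by blast
  have "partition_on J {B\<in>P. B \<subseteq> J}"
  proof (rule partition_onI)
    show "\<Union>{B\<in>P. B \<subseteq> J} = J"
      using partition_onD1[OF part] sat J(1) by blast
  qed (use part in \<open>auto simp: partition_on_def disjoint_def disjnt_def\<close>)
  moreover have "zero_sum G g K \<longleftrightarrow> (\<forall>B\<in>{B\<in>P. B \<subseteq> J}. B \<subseteq> K \<or> B \<inter> K = {})" if "K \<subseteq> J" for K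
  proof -
    have "zero_sum G g K \<longleftrightarrow> (\<forall>B\<in>P. B \<subseteq> K \<or> B \<inter> K = {})"
      using iff[of K] that J by blast
    then show ?thesis using sat that by blast
  qed
  ultimately show ?thesis by (auto simp: zero_sum_blocks_def)
qed

section \<open>Bounds on the number of elements and of blocks\<close>

text \<open>With \<open>I\<close> listed in some order, the \<open>card I + 1\<close> prefix sums
  (the empty one included) are distinct elements of \<open>K\<close>, since two of them differ by
  the sum of a nonempty stretch. A subgroup \<open>K\<close> is allowed so that a block inside the
  cyclic factor can be bounded by the order of that factor alone.\<close>

lemma zero_sum_free_card_less:
  assumes K: "subgroup K G" "finite K" and g: "finite I" "g \<in> I \<rightarrow> K"
    and free: "zero_sum_free G g I"
  shows "card I < card K"
proof -
  have closed: "finprod G g A \<in> K" if "A \<subseteq> I" for A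
    using finite_subset[OF that g(1)] that
  proof (induction A rule: finite_induct)
    case empty
    then show ?case using K by (simp add: subgroup.one_closed)
  next
    case (insert a A)
    then have "g \<in> A \<rightarrow> carrier G" "g a \<in> carrier G" "g a \<in> K"
      using g(2) K subgroup.mem_carrier by fastforce+
    then show ?case using insert K by (auto intro: subgroup.m_closed)
  qed
  have gc: "g \<in> I \<rightarrow> carrier G" using g(2) K subgroup.mem_carrier by fastforce
  obtain f where f: "bij_betw f {..<card I} I"
    using g(1) ex_bij_betw_nat_finite by (metis lessThan_atLeast0)
  define h where "h k = finprod G g (f ` {..<k})" for k
  have "inj_on h {..card I}"
  proof (rule linorder_inj_onI)
    fix k l assume kl: "k < l" "k \<in> {..card I}" "l \<in> {..card I}"
    have inj: "inj_on f {..<card I}" and im: "f ` {..<card I} = I"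
      using f by (auto simp: bij_betw_def)
    have A: "f ` {..<k} \<subseteq> I" "f ` {k..<l} \<subseteq> I" using kl im by force+
    have "f ` {..<l} = f ` {..<k} \<union> f ` {k..<l}"
      using kl by (metis image_Un ivl_disj_un_one(2) less_imp_le)
    moreover have "f ` {..<k} \<inter> f ` {k..<l} = {}"
      using kl inj_on_image_Int[OF inj, of "{..<k}" "{k..<l}"] by fastforce
    ultimately have "h l = h k \<otimes> finprod G g (f ` {k..<l})"
      using A gc unfolding h_def by (auto simp: finprod_Un_disjoint Pi_def subset_iff)
    moreover have "finprod G g (f ` {k..<l}) \<noteq> \<one>"
      using free A kl by (auto simp: zero_sum_free_def zero_sum_def)
    moreover have "h k \<in> carrier G" "finprod G g (f ` {k..<l}) \<in> carrier G"
      unfolding h_def using A gc by (auto intro!: finprod_closed simp: subset_iff)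
    ultimately show "h k \<noteq> h l" by (metis l_cancel_one')
  qed auto
  moreover have "h ` {..card I} \<subseteq> K"
  proof
    fix y assume "y \<in> h ` {..card I}"
    then obtain k where "k \<le> card I" "y = h k" by auto
    moreover from this have "f ` {..<k} \<subseteq> I" using f by (auto simp: bij_betw_def)
    ultimately show "y \<in> K" using closed by (simp add: h_def)
  qed
  ultimately have "card {..card I} \<le> card K" using K(2) card_inj_on_le by blast
  then show ?thesis by simp
qed

text \<open>A nonempty zero-sum set contains a whole block, hence also the chosen element of that
  block, which has been removed.\<close>

lemma zero_sum_free_Diff_transversal:
  assumes P: "zero_sum_blocks G g I P" and f: "\<And>B. B \<in> P \<Longrightarrow> f B \<in> B"
  shows "zero_sum_free G g (I - f ` P)"
  unfolding zero_sum_free_def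
proof (intro allI impI notI)
  fix J assume J: "J \<noteq> {} \<and> J \<subseteq> I - f ` P" "zero_sum G g J"
  then obtain x where "x \<in> J" "x \<in> I" by blast
  then obtain B where B: "x \<in> B" "B \<in> P" using P by (auto simp: zero_sum_blocks_def partition_on_def)
  then have "B \<subseteq> J" using P J \<open>x \<in> J\<close> by (auto simp: zero_sum_blocks_def)
  then show False using f[OF B(2)] B J by blast
qed

lemma ex_transversal:
  assumes "partition_on I P"
  obtains f where "\<And>B. B \<in> P \<Longrightarrow> f B \<in> B"
proof -
  have "\<exists>f. \<forall>B\<in>P. f B \<in> B"
    by (rule bchoice) (use partition_onD3[OF assms] in \<open>metis all_not_in_conv\<close>)
  then show ?thesis using that by blast
qed

lemma transversal_inj_on:
  assumes "partition_on I P" "\<And>B. B \<in> P \<Longrightarrow> f B \<in> B"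
  shows "inj_on f P"
proof (rule inj_onI)
  fix B C assume "B \<in> P" "C \<in> P" "f B = f C"
  then show "B = C"
    using disjointD[OF partition_onD2[OF assms(1)], of B C] assms(2)[of B] assms(2)[of C] by auto
qed

text \<open>
  One element is chosen from each block: two sets of chosen elements with equal sums would give a
  zero-sum set containing all but one element of some block.
\<close>

lemma two_power_card_blocks_le:
  assumes P: "zero_sum_blocks G g I P" and g: "finite I" "g \<in> I \<rightarrow> carrier G - {\<one>}"
    and fin: "finite (carrier G)"
  shows "2 ^ card P \<le> order G"
proof -
  have part: "partition_on I P"
    and iff: "\<And>J. J \<subseteq> I \<Longrightarrow> zero_sum G g J \<longleftrightarrow> (\<forall>B\<in>P. B \<subseteq> J \<or> B \<inter> J = {})"
    using P by (auto simp: zero_sum_blocks_def)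
  have gc: "g \<in> I \<rightarrow> carrier G" using g by auto
  have U: "\<Union>P = I" using part by (auto simp: partition_on_def)
  have finP: "finite P" using finite_elements[OF g(1) part] .
  obtain f where f: "\<And>B. B \<in> P \<Longrightarrow> f B \<in> B" using ex_transversal[OF part] by blast
  have inj_f: "inj_on f P" using transversal_inj_on[OF part f] .
  have disj: "B = C" if "B \<in> P" "C \<in> P" "x \<in> B" "x \<in> C" for B C x
    using disjointD[OF partition_onD2[OF part] that(1,2)] that(3,4) by blast
  have blocks: "zero_sum G g B" if "B \<in> P" for B
    using iff[of B] disj that U by blast
  have sum_f: "finprod G g (f ` X) = finprod G g (f ` (X - Y)) \<otimes> finprod G g (f ` (X \<inter> Y))"
    if "X \<subseteq> P" for X Y
  proof -
    have "f ` X = f ` (X - Y) \<union> f ` (X \<inter> Y)" by blast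
    moreover have "f ` (X - Y) \<inter> f ` (X \<inter> Y) = {}"
      using inj_f that by (auto dest!: inj_onD)
    moreover have "finite (f ` (X - Y))" "finite (f ` (X \<inter> Y))"
      using finite_subset[OF that finP] by auto
    moreover have "g \<in> f ` (X - Y) \<rightarrow> carrier G" "g \<in> f ` (X \<inter> Y) \<rightarrow> carrier G"
      using gc f that U by blast+
    ultimately show ?thesis using finprod_Un_disjoint by metis
  qed
  have sub: "X \<subseteq> Y" if XY: "X \<subseteq> P" "Y \<subseteq> P"
    and eq: "finprod G g (f ` X) = finprod G g (f ` Y)" for X Y
  proof (rule ccontr)
    assume "\<not> X \<subseteq> Y"
    then obtain B where B: "B \<in> X" "B \<notin> Y" "B \<in> P" using XY by blast
    \<comment> \<open>In the union of the blocks in \<open>X - Y\<close> the chosen elements are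
      exchanged for those of \<open>Y - X\<close>; as the two sums agree, the total remains
      zero.\<close>
    define J where "J = (\<Union>(X - Y) - f ` (X - Y)) \<union> f ` (Y - X)"
    have fsub: "f ` Z \<subseteq> I" if "Z \<subseteq> P" for Z using f U that by blast
    have mem: "g \<in> A \<rightarrow> carrier G" if "A \<subseteq> I" for A using gc that by auto
    have cl: "finprod G g (f ` Z) \<in> carrier G" if "Z \<subseteq> P" for Z
      using finprod_closed[OF mem[OF fsub[OF that]]] .
    have "finprod G g (f ` (X - Y)) \<otimes> finprod G g (f ` (X \<inter> Y))
        = finprod G g (f ` (Y - X)) \<otimes> finprod G g (f ` (X \<inter> Y))"
      using sum_f[OF XY(1), of Y] sum_f[OF XY(2), of X] eq by (simp add: Int_commute)
    moreover have "X - Y \<subseteq> P" "Y - X \<subseteq> P" "X \<inter> Y \<subseteq> P" using XY by auto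
    ultimately have eq': "finprod G g (f ` (X - Y)) = finprod G g (f ` (Y - X))"
      using cl by (meson right_cancel)
    have JI: "J \<subseteq> I" using U XY fsub[of "Y - X"] by (auto simp: J_def)
    have "finprod G g J = finprod G g (\<Union>(X - Y) - f ` (X - Y)) \<otimes> finprod G g (f ` (Y - X))"
      unfolding J_def
    proof (rule finprod_Un_disjoint)
      show "(\<Union>(X - Y) - f ` (X - Y)) \<inter> f ` (Y - X) = {}"
      proof (rule ccontr)
        assume "\<not> ?thesis"
        then obtain C D where "C \<in> X - Y" "D \<in> Y - X" "f D \<in> C" by blast
        then show False using disj[of C D "f D"] f XY by blast
      qed
      show "finite (\<Union>(X - Y) - f ` (X - Y))" "finite (f ` (Y - X))"
        "g \<in> \<Union>(X - Y) - f ` (X - Y) \<rightarrow> carrier G" "g \<in> f ` (Y - X) \<rightarrow> carrier G"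
        using JI g(1) mem finite_subset unfolding J_def by (meson le_sup_iff)+
    qed
    also have "\<dots> = finprod G g (\<Union>(X - Y) - f ` (X - Y)) \<otimes> finprod G g (f ` (X - Y))"
      using eq' by simp
    also have "\<dots> = finprod G g ((\<Union>(X - Y) - f ` (X - Y)) \<union> f ` (X - Y))"
    proof (rule finprod_Un_disjoint[symmetric])
      show "finite (\<Union>(X - Y) - f ` (X - Y))" "g \<in> \<Union>(X - Y) - f ` (X - Y) \<rightarrow> carrier G"
        using JI g(1) mem finite_subset unfolding J_def by (meson le_sup_iff)+
      show "finite (f ` (X - Y))" "g \<in> f ` (X - Y) \<rightarrow> carrier G"
        using fsub[of "X - Y"] XY mem finite_subset[OF _ g(1)] by blast+
    qed auto
    also have "(\<Union>(X - Y) - f ` (X - Y)) \<union> f ` (X - Y) = \<Union>(X - Y)"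
      using f XY by blast
    also have "finprod G g (\<Union>(X - Y)) = \<one>"
      using zero_sum_Union[OF g(1) part gc blocks, of "X - Y"] XY by (auto simp: zero_sum_def)
    finally have "zero_sum G g J" by (simp add: zero_sum_def)
    then have sat: "B \<subseteq> J \<or> B \<inter> J = {}" using iff[OF JI] B by blast
    have "f B \<notin> J"
    proof
      assume "f B \<in> J"
      then obtain C where "C \<in> Y" "f B = f C" using B by (auto simp: J_def)
      then show False using inj_onD[OF inj_f, of B C] B XY by blast
    qed
    then have empty: "B \<inter> J = {}" using sat f B by blast
    \<comment> \<open>Apart from \<open>f B\<close>, every element of \<open>B\<close> lies in
      \<open>J\<close>, which is disjoint from \<open>B\<close>. So \<open>B\<close> is a singleton,
      and its element would have to be the identity.\<close>
    have "B \<subseteq> {f B}"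
    proof
      fix x assume x: "x \<in> B"
      show "x \<in> {f B}"
      proof (rule ccontr)
        assume "x \<notin> {f B}"
        moreover have "x \<noteq> f C" if "C \<in> X - Y" "C \<noteq> B" for C
          using disj[of B C x] f that x B XY by blast
        ultimately have "x \<in> J" using x B by (auto simp: J_def)
        then show False using empty x by blast
      qed
    qed
    then have "B = {f B}" using f B by blast
    then have "zero_sum G g {f B}" using blocks B by metis
    moreover have "g (f B) \<in> carrier G - {\<one>}" using g(2) f B U by blast
    ultimately show False by (simp add: zero_sum_def)
  qed
  have "inj_on (\<lambda>X. finprod G g (f ` X)) (Pow P)"
  proof (rule inj_onI)
    fix X Y assume "X \<in> Pow P" "Y \<in> Pow P" "finprod G g (f ` X) = finprod G g (f ` Y)"
    then show "X = Y" using sub[of X Y] sub[of Y X] by simp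
  qed
  moreover have "(\<lambda>X. finprod G g (f ` X)) ` Pow P \<subseteq> carrier G"
    using gc f U by (auto intro!: finprod_closed)
  ultimately have "card (Pow P) \<le> card (carrier G)" using fin by (rule card_inj_on_le)
  then show ?thesis using finP by (simp add: card_Pow order_def)
qed

subsection \<open>Cross numbers\<close>

text \<open>Element orders divide \<open>order G\<close>, so every term is a multiple of
  \<open>1 / order G\<close>. A bound on the length then leaves finitely many values, which makes
  the maxima in \<open>K1\<close> and \<open>little_k\<close> meaningful.\<close>

lemma cross_number_quantized:
  assumes fin: "finite (carrier G)" and g: "g \<in> I \<rightarrow> carrier G" and M: "card I \<le> M"
  shows "cross_number G g I \<in> (\<lambda>k. real k / real (order G)) ` {..M * order G}"
proof -
  have pos: "order G > 0" using fin by (simp add: order_gt_0_iff_finite)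
  define m where "m i = order G div ord (g i)" for i
  have m: "1 / real (ord (g i)) = real (m i) / real (order G)" "m i \<le> order G" if "i \<in> I" for i
  proof -
    have "ord (g i) dvd order G" using g that by (intro ord_dvd_group_order) auto
    then show "1 / real (ord (g i)) = real (m i) / real (order G)"
      using pos by (auto simp: m_def real_of_nat_div)
    show "m i \<le> order G" by (simp add: m_def)
  qed
  have "cross_number G g I = real (\<Sum>i\<in>I. m i) / real (order G)"
    by (simp add: cross_number_def m sum_divide_distrib)
  moreover have "(\<Sum>i\<in>I. m i) \<le> M * order G"
  proof -
    have "(\<Sum>i\<in>I. m i) \<le> card I * order G" using sum_bounded_above[of I m "order G"] m(2) by simp
    also have "\<dots> \<le> M * order G" using M by simp
    finally show ?thesis .
  qed
  ultimately show ?thesis by blast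
qed

lemma finite_zero_sum_free_cross_numbers:
  assumes "finite (carrier G)"
  shows "finite {cross_number G g I | g I.
    indexed_multiset (carrier G - {\<one>}) g I \<and> zero_sum_free G g I}"
proof (rule finite_subset)
  show "{cross_number G g I | g I. indexed_multiset (carrier G - {\<one>}) g I \<and> zero_sum_free G g I}
      \<subseteq> (\<lambda>k. real k / real (order G)) ` {..order G * order G}"
  proof clarify
    fix g I assume *: "indexed_multiset (carrier G - {\<one>}) g I" "zero_sum_free G g I"
    then have g: "finite I" "g \<in> I \<rightarrow> carrier G" by (auto simp: indexed_multiset_def)
    have "card I < card (carrier G)"
      using zero_sum_free_card_less[OF subgroup_self assms g *(2)] .
    then show "cross_number G g I \<in> (\<lambda>k. real k / real (order G)) ` {..order G * order G}"
      using cross_number_quantized[OF assms g(2)] by (simp add: order_def)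
  qed
qed simp

lemma cross_number_le_little_k:
  assumes "finite (carrier G)" "indexed_multiset (carrier G - {\<one>}) g I" "zero_sum_free G g I"
  shows "cross_number G g I \<le> little_k G"
  unfolding little_k_def
  by (rule Max_ge[OF finite_zero_sum_free_cross_numbers[OF assms(1)]]) (use assms in blast)

text \<open>Removing a transversal leaves a zero-sum free multiset of fewer than
  \<open>order G\<close> elements, and the number of removed elements is less than
  \<open>2 ^ card P\<close>, hence less than \<open>order G\<close>.\<close>

lemma zero_sum_blocks_card_le:
  assumes P: "zero_sum_blocks G g I P" and g: "finite I" "g \<in> I \<rightarrow> carrier G - {\<one>}"
    and fin: "finite (carrier G)"
  shows "card I \<le> 2 * order G"
proof -
  have part: "partition_on I P" using P by (simp add: zero_sum_blocks_def)
  obtain f where f: "\<And>B. B \<in> P \<Longrightarrow> f B \<in> B" using ex_transversal[OF part] by blast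
  have "card (I - f ` P) < card (carrier G)"
    using zero_sum_free_card_less[OF subgroup_self fin _ _ zero_sum_free_Diff_transversal[OF P f]] g
    by auto
  moreover have "card (f ` P) \<le> order G"
  proof -
    have "card (f ` P) \<le> card P" using card_image_le finite_elements[OF g(1) part] by blast
    also have "\<dots> < 2 ^ card P" by (rule less_exp)
    also have "\<dots> \<le> order G" using two_power_card_blocks_le[OF P g fin] .
    finally show ?thesis by simp
  qed
  moreover have "card I \<le> card (I - f ` P) + card (f ` P)"
    using diff_card_le_card_Diff[of "f ` P" I] finite_elements[OF g(1) part] by simp
  ultimately show ?thesis by (simp add: order_def)
qed

lemma finite_ufim_cross_numbers:
  assumes "finite (carrier G)"
  shows "finite {cross_number G g I | g I. ufim G (carrier G - {\<one>}) g I}"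
proof (rule finite_subset)
  show "{cross_number G g I | g I. ufim G (carrier G - {\<one>}) g I}
      \<subseteq> (\<lambda>k. real k / real (order G)) ` {..2 * order G * order G}"
  proof clarify
    fix g I assume *: "ufim G (carrier G - {\<one>}) g I"
    then obtain P where P: "zero_sum_blocks G g I P"
      and g: "finite I" "g \<in> I \<rightarrow> carrier G - {\<one>}"
      by (auto simp: ufim_iff indexed_multiset_def)
    have "g \<in> I \<rightarrow> carrier G" using g by auto
    then show "cross_number G g I \<in> (\<lambda>k. real k / real (order G)) ` {..2 * order G * order G}"
      using cross_number_quantized[OF assms _ zero_sum_blocks_card_le[OF P g assms]] by simp
  qed
qed simp

lemma cross_number_le_K1:
  assumes "finite (carrier G)" "ufim G (carrier G - {\<one>}) g I"
  shows "cross_number G g I \<le> K1 G"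
  unfolding K1_def
  by (rule Max_ge[OF finite_ufim_cross_numbers[OF assms(1)]]) (use assms in blast)

lemma K1_attained:
  assumes "finite (carrier G)"
  obtains g I where "ufim G (carrier G - {\<one>}) g I" "cross_number G g I = K1 G"
proof -
  \<comment> \<open>The empty multiset, with no blocks, shows that the maximum is taken over a
    nonempty set.\<close>
  have "zero_sum_blocks G g {} {}" for g
    by (simp add: zero_sum_blocks_def partition_on_empty)
  then have "ufim G (carrier G - {\<one>}) g {}" for g
    by (subst ufim_iff) (auto simp: indexed_multiset_def)
  then have "{cross_number G g I | g I. ufim G (carrier G - {\<one>}) g I} \<noteq> {}" by blast
  then have "K1 G \<in> {cross_number G g I | g I. ufim G (carrier G - {\<one>}) g I}"
    unfolding K1_def using Max_in finite_ufim_cross_numbers[OF assms] by blast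
  then obtain g I where "ufim G (carrier G - {\<one>}) g I" "cross_number G g I = K1 G"
    by (auto simp: eq_commute)
  then show ?thesis by (rule that)
qed

text \<open>Taking an element of order at least \<open>q\<close> out of each block costs at most
  \<open>1 / q\<close> per block and leaves a zero-sum free multiset.\<close>

lemma cross_number_le_little_k_plus:
  assumes P: "zero_sum_blocks G g I P" and g: "finite I" "g \<in> I \<rightarrow> carrier G - {\<one>}"
    and fin: "finite (carrier G)" and q: "q > 0"
    and large: "\<And>B. B \<in> P \<Longrightarrow> \<exists>i\<in>B. q \<le> ord (g i)"
  shows "cross_number G g I \<le> little_k G + log 2 (real (order G)) / real q"
proof -
  have part: "partition_on I P" using P by (simp add: zero_sum_blocks_def)
  have finP: "finite P" using finite_elements[OF g(1) part] .
  obtain f where f: "\<And>B. B \<in> P \<Longrightarrow> f B \<in> B \<and> q \<le> ord (g (f B))"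
    using large by metis
  have inj: "inj_on f P" using transversal_inj_on[OF part] f by blast
  have fI: "f ` P \<subseteq> I" using f partition_onD1[OF part] by blast
  have "cross_number G g I = cross_number G g (I - f ` P) + (\<Sum>i\<in>f ` P. 1 / real (ord (g i)))"
    unfolding cross_number_def using g(1) fI by (simp add: sum.subset_diff)
  also have "cross_number G g (I - f ` P) \<le> little_k G"
  proof (rule cross_number_le_little_k[OF fin])
    show "indexed_multiset (carrier G - {\<one>}) g (I - f ` P)"
      using g by (auto simp: indexed_multiset_def)
    show "zero_sum_free G g (I - f ` P)" using zero_sum_free_Diff_transversal[OF P] f by blast
  qed
  also have "(\<Sum>i\<in>f ` P. 1 / real (ord (g i))) \<le> (\<Sum>B\<in>P. 1 / real q)"
    unfolding sum.reindex[OF inj]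
  proof (rule sum_mono)
    fix B assume "B \<in> P"
    then show "((\<lambda>i. 1 / real (ord (g i))) \<circ> f) B \<le> 1 / real q"
      using f[of B] q by (auto simp: frac_le)
  qed
  also have "\<dots> = real (card P) / real q" by simp
  also have "\<dots> \<le> log 2 (real (order G)) / real q"
  proof (rule divide_right_mono)
    have "real (2 ^ card P) \<le> real (order G)"
      using two_power_card_blocks_le[OF P g fin] of_nat_le_iff by blast
    then show "real (card P) \<le> log 2 (real (order G))"
      by (intro le_log_of_power) auto
  qed simp
  finally show ?thesis by simp
qed

end

subsection \<open>Direct products\<close>

lemma DirProd_comm_group:
  assumes "comm_group C" "comm_group G"
  shows "comm_group (C \<times>\<times> G)"
proof (rule group.group_comm_groupI)
  interpret C: comm_group C by fact
  interpret G: comm_group G by fact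
  show "group (C \<times>\<times> G)" by (rule DirProd_group) unfold_locales
  show "x \<otimes>\<^bsub>C \<times>\<times> G\<^esub> y = y \<otimes>\<^bsub>C \<times>\<times> G\<^esub> x" if "x \<in> carrier (C \<times>\<times> G)" "y \<in> carrier (C \<times>\<times> G)" for x y
    using that by (auto simp: C.m_comm G.m_comm)
qed

lemma finprod_DirProd:
  assumes "comm_group C" "comm_group G" "finite I" "g \<in> I \<rightarrow> carrier C \<times> carrier G"
  shows "finprod (C \<times>\<times> G) g I = (finprod C (fst \<circ> g) I, finprod G (snd \<circ> g) I)"
proof -
  interpret C: comm_group C by fact
  interpret G: comm_group G by fact
  interpret H: comm_group "C \<times>\<times> G" using assms by (intro DirProd_comm_group)
  show ?thesis using assms(3,4)
  proof (induction I rule: finite_induct)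
    case empty
    then show ?case by simp
  next
    case (insert i I)
    have "g i \<in> carrier C \<times> carrier G" "g \<in> I \<rightarrow> carrier C \<times> carrier G" using insert by auto
    moreover from this have "fst \<circ> g \<in> I \<rightarrow> carrier C" "snd \<circ> g \<in> I \<rightarrow> carrier G"
      "fst (g i) \<in> carrier C" "snd (g i) \<in> carrier G" by (fastforce simp: Pi_iff)+
    ultimately show ?case
      using insert C.finprod_insert[of I i "fst \<circ> g"] G.finprod_insert[of I i "snd \<circ> g"]
      by (simp add: mult_DirProd' comp_def)
  qed
qed

lemma pow_DirProd:
  fixes n :: nat
  shows "x [^]\<^bsub>C \<times>\<times> G\<^esub> n = (fst x [^]\<^bsub>C\<^esub> n, snd x [^]\<^bsub>G\<^esub> n)"
  by (induction n) (auto simp: mult_DirProd')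

text \<open>Both sides divide the same \<open>n\<close>, namely the exponents that annihilate both
  components.\<close>

lemma ord_DirProd:
  assumes "group C" "group G" "x \<in> carrier (C \<times>\<times> G)"
  shows "group.ord (C \<times>\<times> G) x = lcm (group.ord C (fst x)) (group.ord G (snd x))"
proof -
  interpret C: group C by fact
  interpret G: group G by fact
  interpret H: group "C \<times>\<times> G" using assms by (intro DirProd_group)
  have "fst x \<in> carrier C" "snd x \<in> carrier G" using assms(3) by auto
  then have "H.ord x dvd n \<longleftrightarrow> lcm (C.ord (fst x)) (G.ord (snd x)) dvd n" for n
    using assms(3) by (simp add: H.pow_eq_id[symmetric] C.pow_eq_id pow_DirProd G.pow_eq_id)
  then show ?thesis by (meson dvd_antisym dvd_refl)
qed

lemma order_DirProd: "order (C \<times>\<times> G) = order C * order G"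
  by (simp add: order_def card_cartesian_product)

subsection \<open>Adjoining a cyclic group of order 2 or 3\<close>

text \<open>Coprimality ensures that a nonzero component in the cyclic factor strictly raises the
  order of an element, as the equality case requires.\<close>

locale cyclic_extension = comm_group G for G (structure) +
  fixes r :: nat
  assumes r: "r \<in> {2, 3}" and fin: "finite (carrier G)" and coprime: "coprime r (order G)"
begin

abbreviation "C \<equiv> integer_mod_group r"
abbreviation "H \<equiv> C \<times>\<times> G"

sublocale C: comm_group C by simp

sublocale H: comm_group H
  by (intro DirProd_comm_group C.comm_group_axioms comm_group_axioms)

lemma prime_r: "prime r"
  using r by (auto simp: two_is_prime_nat)

lemma r_pos [simp]: "r > 0"
  using r by auto

lemma carrier_C: "carrier C = {0..<int r}"
  by (simp add: carrier_integer_mod_group)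

lemma order_C: "order C = r"
  by (simp add: order_def carrier_C)

lemma finite_carrier_C: "finite (carrier C)"
  by (simp add: carrier_C)

lemma finite_carrier_H: "finite (carrier H)"
  using fin by (simp add: carrier_C)

lemma order_H: "order H = r * order G"
  by (simp add: order_DirProd order_C)

text \<open>This is where \<open>r\<close> at most 3 matters: the cyclic group has one nonzero
  element, or two that are inverse to each other.\<close>

lemma C_eq_or_inverse:
  assumes "a \<in> carrier C" "b \<in> carrier C" "a \<noteq> 0" "b \<noteq> 0"
  shows "a = b \<or> a \<otimes>\<^bsub>C\<^esub> b = 0"
  using assms r unfolding carrier_C
  by (elim insertE) (auto, presburger+)

lemma ord_C:
  assumes "a \<in> carrier C" "a \<noteq> 0"
  shows "C.ord a = r"
proof -
  have "C.ord a dvd r" using C.ord_dvd_group_order[OF assms(1)] by (simp add: order_C)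
  moreover have "C.ord a \<noteq> 1" using C.ord_eq_1[OF assms(1)] assms(2) by simp
  ultimately show ?thesis using prime_r by (auto simp: prime_nat_iff)
qed

lemma zero_sum_H_iff:
  assumes "finite J" "g \<in> J \<rightarrow> carrier H"
  shows "zero_sum H g J \<longleftrightarrow> finprod C (fst \<circ> g) J = 0 \<and> zero_sum G (snd \<circ> g) J"
  using assms by (simp add: zero_sum_def finprod_DirProd[OF C.comm_group_axioms comm_group_axioms])

lemma ord_pos: "x \<in> carrier G \<Longrightarrow> ord x > 0"
  using ord_ge_1[OF fin] by fastforce

lemma ord_H_embed: "x \<in> carrier G \<Longrightarrow> H.ord (0, x) = ord x"
  using ord_DirProd[OF C.is_group is_group, of "(0, x)"] C.ord_id by simp

lemma ord_H_C: "a \<in> carrier C \<Longrightarrow> a \<noteq> 0 \<Longrightarrow> H.ord (a, \<one>) = r"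
  using ord_DirProd[OF C.is_group is_group, of "(a, \<one>)"] ord_C by simp

lemma ord_snd_le_ord_H: "x \<in> carrier H \<Longrightarrow> ord (snd x) \<le> H.ord x"
  using ord_DirProd[OF C.is_group is_group, of x] H.ord_ge_1[OF finite_carrier_H, of x]
  by (auto intro!: dvd_imp_le)

text \<open>By coprimality the order is exactly \<open>r\<close> times that of the second
  component.\<close>

lemma ord_snd_less_ord_H:
  assumes "x \<in> carrier H" "fst x \<noteq> 0"
  shows "ord (snd x) < H.ord x"
proof -
  have x: "fst x \<in> carrier C" "snd x \<in> carrier G" using assms(1) by auto
  have "coprime r (ord (snd x))"
    using coprime ord_dvd_group_order[OF x(2)] coprime_divisors dvd_refl by blast
  then have "H.ord x = r * ord (snd x)"
    using ord_DirProd[OF C.is_group is_group assms(1)] ord_C[OF x(1) assms(2)]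
    by (simp add: lcm_coprime)
  then show ?thesis using ord_pos[OF x(2)] r by auto
qed

section \<open>Multisets with a block inside the cyclic factor\<close>

text \<open>
  If \<open>J\<close> had a sum \<open>(a, \<one>)\<close> with \<open>a \<noteq> 0\<close>, then for \<open>t \<in> T\<close> either \<open>J \<union> {t}\<close> or \<open>J \<union> (T - {t})\<close>
  would be zero-sum, because \<open>r \<le> 3\<close> leaves no nonzero element besides \<open>g t\<close> and its inverse.
\<close>

lemma zero_sum_snd_imp_zero_sum:
  assumes P: "zero_sum_blocks H g I P" and g: "finite I" "g \<in> I \<rightarrow> carrier H - {\<one>\<^bsub>H\<^esub>}"
    and T: "T \<in> P" "\<And>i. i \<in> T \<Longrightarrow> snd (g i) = \<one>"
    and J: "J \<subseteq> I - T" "zero_sum G (snd \<circ> g) J"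
  shows "zero_sum H g J"
proof (rule ccontr)
  assume not: "\<not> zero_sum H g J"
  have part: "partition_on I P"
    and iff: "\<And>J. J \<subseteq> I \<Longrightarrow> zero_sum H g J \<longleftrightarrow> (\<forall>B\<in>P. B \<subseteq> J \<or> B \<inter> J = {})"
    using P by (auto simp: zero_sum_blocks_def)
  have TI: "T \<subseteq> I" "T \<noteq> {}" using part T(1) by (auto simp: partition_on_def)
  have zT: "zero_sum H g T"
    using iff[OF TI(1)] disjointD[OF partition_onD2[OF part], of _ T] T(1) by blast
  have gH: "g \<in> K \<rightarrow> carrier H" "finite K" if "K \<subseteq> I" for K
    using g that by (auto intro: finite_subset)
  have gC: "fst \<circ> g \<in> K \<rightarrow> carrier C" if "K \<subseteq> I" for K
    using g(2) that by (fastforce simp: Pi_iff)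
  obtain t where t: "t \<in> T" using TI by blast
  have t': "g t \<in> carrier H" "snd (g t) = \<one>" "g t \<noteq> \<one>\<^bsub>H\<^esub>" using t T(2) TI g(2) by auto
  have JI: "J \<subseteq> I" "J \<inter> T = {}" using J by auto
  define a where "a = finprod C (fst \<circ> g) J"
  define b where "b = fst (g t)"
  have b: "b \<in> carrier C" "b \<noteq> 0" using t' by (auto simp: b_def)
  have sumJ: "finprod H g J = (a, \<one>)"
    using finprod_DirProd[OF C.comm_group_axioms comm_group_axioms, of J g] gH[OF JI(1)] J(2)
    by (simp add: a_def zero_sum_def)
  have "a \<noteq> 0"
    using not sumJ by (auto simp: zero_sum_def)
  moreover have "a \<in> carrier C" unfolding a_def by (rule C.finprod_closed[OF gC[OF JI(1)]])
  ultimately consider "a \<otimes>\<^bsub>C\<^esub> b = 0" | "a = b" using C_eq_or_inverse b by blast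
  then have "\<exists>J'. zero_sum H g J' \<and> (J' = insert t J \<or> J' = J \<union> (T - {t}))"
  proof cases
    case 1
    have "finprod H g (insert t J) = g t \<otimes>\<^bsub>H\<^esub> finprod H g J"
      by (rule H.finprod_insert) (use gH[OF JI(1)] t t' JI in auto)
    also have "\<dots> = \<one>\<^bsub>H\<^esub>"
      using 1 t' by (simp add: sumJ mult_DirProd' b_def add.commute)
    finally show ?thesis by (auto simp: zero_sum_def)
  next
    case 2
    have D: "T - {t} \<subseteq> I" using TI by auto
    have "finprod H g (J \<union> (T - {t})) = finprod H g J \<otimes>\<^bsub>H\<^esub> finprod H g (T - {t})"
      by (rule H.finprod_Un_disjoint) (use gH[OF JI(1)] gH[OF D] JI in auto)
    also have "finprod H g J = g t"
      using 2 t' by (simp add: sumJ b_def prod_eq_iff)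
    also have "g t \<otimes>\<^bsub>H\<^esub> finprod H g (T - {t}) = finprod H g (insert t (T - {t}))"
      by (rule H.finprod_insert[symmetric]) (use gH[OF D] t' in auto)
    also have "insert t (T - {t}) = T" using t by auto
    finally show ?thesis using zT by (auto simp: zero_sum_def)
  qed
  then obtain J' where J': "zero_sum H g J'" "J' = insert t J \<or> J' = J \<union> (T - {t})" by blast
  have "J' \<subseteq> I" using J' JI t TI by auto
  then have "T \<subseteq> J' \<or> T \<inter> J' = {}" using iff J'(1) T(1) by blast
  \<comment> \<open>The set \<open>insert t J\<close> meets \<open>T\<close> exactly in
    \<open>t\<close>, so it must contain all of \<open>T\<close>; the set \<open>J\<close> together
    with \<open>T - {t}\<close> misses \<open>t\<close>, so it must avoid \<open>T\<close>. Both
    force a singleton block.\<close>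
  then have "T = {t}" using J'(2) JI t by blast
  then show False using zT t' by (simp add: zero_sum_def)
qed

text \<open>For subsets of \<open>I - T\<close>, being zero-sum in \<open>H\<close> and having
  zero-sum projection to \<open>G\<close> are the same by the preceding lemma, so the blocks in
  \<open>H\<close> serve unchanged for the projection.\<close>

lemma ufim_snd:
  assumes P: "zero_sum_blocks H g I P" and g: "finite I" "g \<in> I \<rightarrow> carrier H - {\<one>\<^bsub>H\<^esub>}"
    and T: "T \<in> P" "\<And>i. i \<in> T \<Longrightarrow> snd (g i) = \<one>"
  shows "zero_sum H g T" "zero_sum H g (I - T)"
    "ufim G (carrier G - {\<one>}) (snd \<circ> g) (I - T)"
proof -
  have part: "partition_on I P"
    and iff: "\<And>J. J \<subseteq> I \<Longrightarrow> zero_sum H g J \<longleftrightarrow> (\<forall>B\<in>P. B \<subseteq> J \<or> B \<inter> J = {})"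
    using P by (auto simp: zero_sum_blocks_def)
  have TI: "T \<subseteq> I" using partition_onD1[OF part] T(1) by blast
  have sat: "B = T \<or> B \<inter> T = {}" if "B \<in> P" for B
    using disjointD[OF partition_onD2[OF part] that T(1)] by blast
  show zT: "zero_sum H g T" using iff[OF TI] sat by blast
  have "B \<subseteq> I - T \<or> B \<inter> (I - T) = {}" if "B \<in> P" for B
    using sat[OF that] that partition_onD1[OF part] by blast
  then show zD: "zero_sum H g (I - T)" using iff[of "I - T"] by blast
  have zero_sum_eq: "zero_sum H g J \<longleftrightarrow> zero_sum G (snd \<circ> g) J" if J: "J \<subseteq> I - T" for J
  proof
    have "finite J" "g \<in> J \<rightarrow> carrier H" using J g by (auto intro: finite_subset)
    then show "zero_sum G (snd \<circ> g) J" if "zero_sum H g J"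
      using that zero_sum_H_iff by blast
    show "zero_sum H g J" if "zero_sum G (snd \<circ> g) J"
      using zero_sum_snd_imp_zero_sum[OF P g T J that] .
  qed
  have "zero_sum_blocks H g (I - T) {B\<in>P. B \<subseteq> I - T}"
    by (rule H.zero_sum_blocks_subset[OF P _ zD]) auto
  then have "zero_sum_blocks G (snd \<circ> g) (I - T) {B\<in>P. B \<subseteq> I - T}"
    by (simp add: zero_sum_blocks_def zero_sum_eq)
  moreover have "indexed_multiset (carrier G - {\<one>}) (snd \<circ> g) (I - T)"
    unfolding indexed_multiset_def
  proof (intro conjI funcsetI)
    fix i assume i: "i \<in> I - T"
    then have gi: "g i \<in> carrier H" "g i \<noteq> \<one>\<^bsub>H\<^esub>" "snd (g i) \<in> carrier G"
      using Pi_mem[OF g(2), of i] by auto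
    \<comment> \<open>The equivalence on singletons shows that no projected element is the
      identity.\<close>
    have "\<not> zero_sum H g {i}" using gi by (simp add: zero_sum_def)
    then have "\<not> zero_sum G (snd \<circ> g) {i}" using zero_sum_eq[of "{i}"] i by blast
    then show "(snd \<circ> g) i \<in> carrier G - {\<one>}" using gi by (auto simp: zero_sum_def)
  qed (use g in simp)
  ultimately show "ufim G (carrier G - {\<one>}) (snd \<circ> g) (I - T)"
    by (subst ufim_iff) auto
qed

text \<open>Dropping one element of \<open>T\<close> leaves a zero-sum free multiset over a group of
  order \<open>r\<close>, so \<open>T\<close> has at most \<open>r\<close> elements; each of them
  has order \<open>r\<close>.\<close>

lemma cross_number_C_block_le_1:
  assumes P: "zero_sum_blocks H g I P" and g: "finite I" "g \<in> I \<rightarrow> carrier H - {\<one>\<^bsub>H\<^esub>}"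
    and T: "T \<in> P" "\<And>i. i \<in> T \<Longrightarrow> snd (g i) = \<one>"
  shows "cross_number H g T \<le> 1"
proof -
  have part: "partition_on I P" using P by (simp add: zero_sum_blocks_def)
  have TI: "T \<subseteq> I" "T \<noteq> {}" using part T(1) by (auto simp: partition_on_def)
  have finT: "finite T" using TI g(1) finite_subset by blast
  have gT: "fst (g i) \<in> carrier C" "fst (g i) \<noteq> 0" "g i = (fst (g i), \<one>)" if "i \<in> T" for i
  proof -
    have "g i \<in> carrier H - {\<one>\<^bsub>H\<^esub>}" using g(2) TI that by blast
    then show "fst (g i) \<in> carrier C" "fst (g i) \<noteq> 0" "g i = (fst (g i), \<one>)"
      using T(2)[OF that] by (auto simp: prod_eq_iff)
  qed
  obtain t where t: "t \<in> T" using TI by blast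
  have "zero_sum_free H g (T - {t})"
    unfolding zero_sum_free_def
  proof (intro allI impI notI)
    fix J assume J: "J \<noteq> {} \<and> J \<subseteq> T - {t}" "zero_sum H g J"
    then have "J \<subseteq> I" using TI by blast
    then have "T \<subseteq> J \<or> T \<inter> J = {}" using P J(2) T(1) by (auto simp: zero_sum_blocks_def)
    then show False using J(1) t by blast
  qed
  moreover have "subgroup (carrier C \<times> {\<one>}) H"
    by (rule DirProd_subgroups[OF C.is_group C.subgroup_self is_group triv_subgroup])
  moreover have "g \<in> T - {t} \<rightarrow> carrier C \<times> {\<one>}"
  proof
    fix i assume "i \<in> T - {t}"
    then show "g i \<in> carrier C \<times> {\<one>}" using gT[of i] by (metis DiffD1 SigmaI singletonI)
  qed
  ultimately have "card (T - {t}) < card (carrier C \<times> {\<one>})"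
    using finT finite_carrier_C by (intro H.zero_sum_free_card_less) auto
  then have "card T \<le> r" using t finT by (simp add: carrier_C card_cartesian_product)
  moreover have "cross_number H g T = (\<Sum>i\<in>T. 1 / real r)"
    unfolding cross_number_def using gT ord_H_C by (metis (no_types, lifting) sum.cong)
  ultimately show ?thesis by simp
qed

text \<open>\<open>T\<close> contributes at most 1, and projecting the rest to \<open>G\<close> can
  only lower orders, hence raise the cross number, up to \<open>K1 G\<close>. In the equality case
  no order drops, so all first components outside \<open>T\<close> vanish.\<close>

lemma cross_number_with_C_block:
  assumes P: "zero_sum_blocks H g I P" and g: "finite I" "g \<in> I \<rightarrow> carrier H - {\<one>\<^bsub>H\<^esub>}"
    and T: "T \<in> P" "\<And>i. i \<in> T \<Longrightarrow> snd (g i) = \<one>"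
  shows "cross_number H g I \<le> 1 + K1 G"
    and "cross_number H g I = 1 + K1 G \<Longrightarrow>
      ufim H (carrier C \<times> {\<one>} - {\<one>\<^bsub>H\<^esub>}) g T \<and>
      ufim H ({\<one>\<^bsub>C\<^esub>} \<times> carrier G - {\<one>\<^bsub>H\<^esub>}) g (I - T)"
proof -
  note ufim = ufim_snd[OF P g T]
  have TI: "T \<subseteq> I" using P T(1) by (auto simp: zero_sum_blocks_def partition_on_def)
  have gH: "g i \<in> carrier H" "g i \<noteq> \<one>\<^bsub>H\<^esub>" "fst (g i) \<in> carrier C" "snd (g i) \<in> carrier G"
    if "i \<in> I" for i
    using Pi_mem[OF g(2) that] by auto
  have split: "cross_number H g I = cross_number H g T + cross_number H g (I - T)"
    unfolding cross_number_def using sum.subset_diff[OF TI g(1)] by (simp add: add.commute)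
  have T1: "cross_number H g T \<le> 1" using cross_number_C_block_le_1[OF P g T] .
  have K1: "cross_number G (snd \<circ> g) (I - T) \<le> K1 G" using cross_number_le_K1[OF fin ufim(3)] .
  have le: "1 / real (H.ord (g i)) \<le> 1 / real (ord ((snd \<circ> g) i))" if "i \<in> I - T" for i
    using ord_snd_le_ord_H[of "g i"] ord_pos[of "snd (g i)"] gH(1,4)[of i] that by (simp add: frac_le)
  then have proj: "cross_number H g (I - T) \<le> cross_number G (snd \<circ> g) (I - T)"
    unfolding cross_number_def by (rule sum_mono)
  show "cross_number H g I \<le> 1 + K1 G" using split T1 K1 proj by simp
  assume "cross_number H g I = 1 + K1 G"
  then have eq: "cross_number H g (I - T) = cross_number G (snd \<circ> g) (I - T)"
    using split T1 K1 proj by simp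
  have fst0: "fst (g i) = 0" if i: "i \<in> I - T" for i
  proof (rule ccontr)
    assume "fst (g i) \<noteq> 0"
    then have "1 / real (H.ord (g i)) < 1 / real (ord ((snd \<circ> g) i))"
      using ord_snd_less_ord_H[of "g i"] ord_pos[of "snd (g i)"] gH(1,4)[of i] i
      by (simp add: frac_less2)
    then have "cross_number H g (I - T) < cross_number G (snd \<circ> g) (I - T)"
      unfolding cross_number_def
    proof (intro sum_strict_mono_ex1 ballI bexI)
      show "finite (I - T)" using g(1) by simp
    qed (rule le i | assumption)+
    then show False using eq by simp
  qed
  have "indexed_multiset (carrier C \<times> {\<one>} - {\<one>\<^bsub>H\<^esub>}) g T"
    unfolding indexed_multiset_def
  proof (intro conjI funcsetI)
    show "g i \<in> carrier C \<times> {\<one>} - {\<one>\<^bsub>H\<^esub>}" if "i \<in> T" for i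
      using gH[of i] T(2)[OF that] TI that by (auto simp: mem_Times_iff)
  qed (use TI g(1) finite_subset in blast)
  moreover have "indexed_multiset ({\<one>\<^bsub>C\<^esub>} \<times> carrier G - {\<one>\<^bsub>H\<^esub>}) g (I - T)"
    unfolding indexed_multiset_def
  proof (intro conjI funcsetI)
    show "g i \<in> {\<one>\<^bsub>C\<^esub>} \<times> carrier G - {\<one>\<^bsub>H\<^esub>}" if "i \<in> I - T" for i
      using gH[of i] fst0[OF that] that by (auto simp: mem_Times_iff)
  qed (use g(1) in simp)
  moreover have "\<exists>P. zero_sum_blocks H g T P" "\<exists>P. zero_sum_blocks H g (I - T) P"
    using H.zero_sum_blocks_subset[OF P] TI ufim(1,2) by blast+
  moreover have "carrier C \<times> {\<one>} - {\<one>\<^bsub>H\<^esub>} \<subseteq> carrier H" "{\<one>\<^bsub>C\<^esub>} \<times> carrier G - {\<one>\<^bsub>H\<^esub>} \<subseteq> carrier H"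
    by auto
  ultimately show "ufim H (carrier C \<times> {\<one>} - {\<one>\<^bsub>H\<^esub>}) g T \<and>
      ufim H ({\<one>\<^bsub>C\<^esub>} \<times> carrier G - {\<one>\<^bsub>H\<^esub>}) g (I - T)"
    by (simp only: H.ufim_iff simp_thms)
qed

section \<open>Lower bound for the product and the case distinction\<close>

text \<open>An extremal UFIM over \<open>G\<close> is enlarged by one block, \<open>r\<close> copies
  of the generator 1 of the cyclic factor, whose cross number is 1.\<close>

lemma K1_ge: "1 + K1 G \<le> K1 H"
proof -
  obtain g0 I0 where ufim0: "ufim G (carrier G - {\<one>}) g0 I0" and K1: "cross_number G g0 I0 = K1 G"
    using K1_attained[OF fin] by blast
  then obtain P0 where P0: "zero_sum_blocks G g0 I0 P0"
    and g0: "finite I0" "g0 \<in> I0 \<rightarrow> carrier G - {\<one>}"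
    by (auto simp: ufim_iff indexed_multiset_def)
  have part0: "partition_on I0 P0"
    and iff0: "\<And>J. J \<subseteq> I0 \<Longrightarrow> zero_sum G g0 J \<longleftrightarrow> (\<forall>B\<in>P0. B \<subseteq> J \<or> B \<inter> J = {})"
    using P0 by (auto simp: zero_sum_blocks_def)
  \<comment> \<open>The new block needs \<open>r\<close> indices outside \<open>I0\<close>.\<close>
  have "infinite (- I0)" using g0(1) by (metis finite_compl infinite_UNIV_nat)
  then obtain T where T: "finite T" "card T = r" "T \<inter> I0 = {}"
    using infinite_arbitrarily_large[of "- I0" r] by blast
  have C1: "1 \<in> carrier C" "1 \<noteq> (0::int)" using r by (auto simp: carrier_C)
  have C0: "(0::int) \<in> carrier C" by simp
  define g where "g i = (if i \<in> T then (1, \<one>) else (0::int, g0 i))" for i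
  define I where "I = I0 \<union> T"
  have g: "g \<in> I \<rightarrow> carrier H - {\<one>\<^bsub>H\<^esub>}"
  proof
    fix i assume "i \<in> I"
    then show "g i \<in> carrier H - {\<one>\<^bsub>H\<^esub>}"
      using C1 g0(2) by (auto simp: g_def I_def)
  qed
  have finI: "finite I" using g0(1) T(1) by (simp add: I_def)
  have "zero_sum_blocks H g I (insert T P0)"
    unfolding zero_sum_blocks_def
  proof (intro conjI allI impI)
    have "disjnt T (\<Union>P0)" using partition_onD1[OF part0] T(3) by (auto simp: disjnt_def)
    moreover have "I - T = I0" "T \<subseteq> I" "T \<noteq> {}" using T r by (auto simp: I_def)
    ultimately show "partition_on I (insert T P0)" using part0 by (simp add: partition_on_insert)
    fix J assume J: "J \<subseteq> I"
    have finJ: "finite J" using J finI finite_subset by blast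
    have gJ: "g \<in> J \<rightarrow> carrier H" using J g by auto
    \<comment> \<open>The first component counts the indices of \<open>T\<close> in \<open>J\<close>
      modulo \<open>r\<close>. As \<open>card T = r\<close>, it vanishes exactly when
      \<open>J\<close> contains all of \<open>T\<close> or none of it.\<close>
    have "finprod C (fst \<circ> g) J = finprod C (\<lambda>_. 1) (J \<inter> T)"
      by (rule C.finprod_mono_neutral_cong_right[OF finJ]) (use C0 C1 in \<open>auto simp: g_def\<close>)
    also have "\<dots> = int (card (J \<inter> T)) mod int r"
      using C.finprod_const[OF C1(1)] by simp
    also have "\<dots> = int (card (J \<inter> T) mod r)" by (simp add: zmod_int)
    finally have sumC: "finprod C (fst \<circ> g) J = 0 \<longleftrightarrow> r dvd card (J \<inter> T)" by (simp add: mod_eq_0_iff_dvd)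
    have "r dvd card (J \<inter> T) \<longleftrightarrow> T \<subseteq> J \<or> T \<inter> J = {}"
    proof
      assume dvd: "r dvd card (J \<inter> T)"
      show "T \<subseteq> J \<or> T \<inter> J = {}"
      proof (cases "card (J \<inter> T) = 0")
        case True
        then show ?thesis using finJ by auto
      next
        case False
        then have "card T \<le> card (J \<inter> T)" using dvd T(2) by (simp add: dvd_imp_le)
        then have "J \<inter> T = T" using card_seteq[OF T(1)] by blast
        then show ?thesis by blast
      qed
    next
      assume "T \<subseteq> J \<or> T \<inter> J = {}"
      then have "J \<inter> T = T \<or> J \<inter> T = {}" by blast
      then show "r dvd card (J \<inter> T)" using T(2) by auto
    qed
    moreover have "finprod G (snd \<circ> g) J = finprod G g0 (J \<inter> I0)"
      by (rule finprod_mono_neutral_cong_right[OF finJ]) (use J T(3) Pi_mem[OF g0(2)] in \<open>auto simp: g_def I_def\<close>)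
    then have "zero_sum G (snd \<circ> g) J \<longleftrightarrow> (\<forall>B\<in>P0. B \<subseteq> J \<inter> I0 \<or> B \<inter> (J \<inter> I0) = {})"
      using iff0[of "J \<inter> I0"] by (simp add: zero_sum_def)
    moreover have "B \<subseteq> J \<inter> I0 \<longleftrightarrow> B \<subseteq> J" "B \<inter> (J \<inter> I0) = B \<inter> J" if "B \<in> P0" for B
      using partition_onD1[OF part0] that by blast+
    ultimately show "zero_sum H g J \<longleftrightarrow> (\<forall>B\<in>insert T P0. B \<subseteq> J \<or> B \<inter> J = {})"
      using zero_sum_H_iff[OF finJ gJ] sumC by simp
  qed
  then have "ufim H (carrier H - {\<one>\<^bsub>H\<^esub>}) g I"
    using finI g by (subst H.ufim_iff) (auto simp: indexed_multiset_def)
  then have "cross_number H g I \<le> K1 H" by (rule H.cross_number_le_K1[OF finite_carrier_H])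
  moreover have "cross_number H g I = cross_number H g I0 + cross_number H g T"
    unfolding cross_number_def I_def using g0(1) T by (intro sum.union_disjoint) auto
  moreover have "cross_number H g I0 = cross_number G g0 I0"
    unfolding cross_number_def
  proof (rule sum.cong)
    fix i assume "i \<in> I0"
    then have "g i = (0, g0 i)" "g0 i \<in> carrier G" using T(3) g0(2) by (auto simp: g_def)
    then show "1 / real (H.ord (g i)) = 1 / real (ord (g0 i))" using ord_H_embed by simp
  qed simp
  moreover have "cross_number H g T = 1"
    using T(2) r ord_H_C[OF C1] by (auto simp: cross_number_def g_def)
  ultimately show ?thesis using K1 by simp
qed

text \<open>A block not contained in the cyclic factor has an element with nontrivial
  \<open>G\<close>-component, whose order is therefore at least \<open>q\<close>. In the application
  \<open>q\<close> is the smallest prime \<open>p 1\<close>.\<close>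

lemma ufim_cross_number_cases:
  assumes S: "ufim H (carrier H - {\<one>\<^bsub>H\<^esub>}) g I"
    and q: "q > 0" "\<forall>x\<in>carrier G - {\<one>}. q \<le> ord x"
  obtains (no_C_block) "cross_number H g I \<le> little_k H + log 2 (real (order H)) / real q"
    | (C_block) T where "T \<subseteq> I" "cross_number H g I \<le> 1 + K1 G"
      "cross_number H g I = 1 + K1 G \<Longrightarrow>
        ufim H (carrier C \<times> {\<one>} - {\<one>\<^bsub>H\<^esub>}) g T \<and>
        ufim H ({\<one>\<^bsub>C\<^esub>} \<times> carrier G - {\<one>\<^bsub>H\<^esub>}) g (I - T)"
proof -
  obtain P where P: "zero_sum_blocks H g I P"
    and g: "finite I" "g \<in> I \<rightarrow> carrier H - {\<one>\<^bsub>H\<^esub>}"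
    using S by (auto simp: H.ufim_iff indexed_multiset_def)
  show ?thesis
  proof (cases "\<exists>T\<in>P. \<forall>i\<in>T. snd (g i) = \<one>")
    case True
    then obtain T where T: "T \<in> P" "\<And>i. i \<in> T \<Longrightarrow> snd (g i) = \<one>" by blast
    moreover have "T \<subseteq> I" using P T(1) by (auto simp: zero_sum_blocks_def partition_on_def)
    ultimately show ?thesis using C_block cross_number_with_C_block[OF P g T] by blast
  next
    case False
    have "\<exists>i\<in>B. q \<le> H.ord (g i)" if "B \<in> P" for B
    proof -
      obtain i where i: "i \<in> B" "snd (g i) \<noteq> \<one>" using False \<open>B \<in> P\<close> by blast
      then have "i \<in> I" using P \<open>B \<in> P\<close> by (auto simp: zero_sum_blocks_def partition_on_def)
      then have "g i \<in> carrier H" "snd (g i) \<in> carrier G" using Pi_mem[OF g(2), of i] by auto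
      then have "q \<le> H.ord (g i)" using q(2) i(2) ord_snd_le_ord_H le_trans by (metis DiffI singletonD)
      then show ?thesis using i(1) by blast
    qed
    then show ?thesis
      using no_C_block H.cross_number_le_little_k_plus[OF P g finite_carrier_H q(1)] by blast
  qed
qed

end

subsection \<open>Sums of cyclic groups of prime power order\<close>

text \<open>Over a finite index set the finite-support condition of the direct sum always holds, so
  the carrier is the full product.\<close>

lemma sum_group_integer_mod_group:
  assumes "finite K" "\<And>k. k \<in> K \<Longrightarrow> m k > 0"
  shows "comm_group (sum_group K (\<lambda>k. integer_mod_group (m k)))" (is "comm_group ?G")
    and "carrier (sum_group K (\<lambda>k. integer_mod_group (m k))) = (\<Pi>\<^sub>E k\<in>K. {0..<int (m k)})"
proof -
  show "carrier ?G = (\<Pi>\<^sub>E k\<in>K. {0..<int (m k)})"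
    using assms by (auto simp: carrier_sum_group carrier_integer_mod_group PiE_iff extensional_def)
  show "comm_group ?G"
    by (rule group.group_comm_groupI) (auto simp: add.commute)
qed

lemma cyclic_sum_facts:
  assumes "finite A" "\<And>i. i \<in> A \<Longrightarrow> p i > 0"
  shows comm_group_cyclic_sum: "comm_group (cyclic_sum A p N e)"
    and finite_cyclic_sum: "finite (carrier (cyclic_sum A p N e))"
    and order_cyclic_sum: "order (cyclic_sum A p N e) = (\<Prod>i\<in>A. p i ^ (\<Sum>j=1..N i. e i j))"
proof -
  \<comment> \<open>Pairs \<open>(i, j)\<close> serve as a single index; regrouping by
    \<open>i\<close> at the end adds up the exponents of each \<open>p i\<close>.\<close>
  define K where "K = (SIGMA i:A. {1..N i})"
  define m where "m = (\<lambda>k. p (fst k) ^ e (fst k) (snd k))"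
  have K: "finite K" using assms(1) by (simp add: K_def)
  have m: "m k > 0" if "k \<in> K" for k using assms(2) that by (auto simp: K_def m_def)
  have eq: "cyclic_sum A p N e = sum_group K (\<lambda>k. integer_mod_group (m k))"
    by (simp add: cyclic_sum_def K_def m_def case_prod_unfold)
  show "comm_group (cyclic_sum A p N e)"
    unfolding eq by (rule sum_group_integer_mod_group(1)[OF K m])
  have carrier: "carrier (cyclic_sum A p N e) = (\<Pi>\<^sub>E k\<in>K. {0..<int (m k)})"
    unfolding eq by (rule sum_group_integer_mod_group(2)[OF K m])
  show "finite (carrier (cyclic_sum A p N e))" unfolding carrier using K by (simp add: finite_PiE)
  have "order (cyclic_sum A p N e) = (\<Prod>k\<in>K. m k)"
    unfolding order_def carrier using K by (simp add: card_PiE)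
  also have "\<dots> = (\<Prod>i\<in>A. \<Prod>j=1..N i. p i ^ e i j)"
    unfolding K_def using assms(1) by (subst prod.Sigma) (auto simp: m_def case_prod_unfold)
  also have "\<dots> = (\<Prod>i\<in>A. p i ^ (\<Sum>j=1..N i. e i j))" by (simp add: power_sum)
  finally show "order (cyclic_sum A p N e) = (\<Prod>i\<in>A. p i ^ (\<Sum>j=1..N i. e i j))" .
qed

lemma prime_dvd_order_cyclic_sum:
  assumes "finite A" "\<And>i. i \<in> A \<Longrightarrow> prime (p i)"
    and "prime s" "s dvd order (cyclic_sum A p N e)"
  shows "\<exists>i\<in>A. s = p i"
proof -
  have "\<And>i. i \<in> A \<Longrightarrow> p i > 0" using assms(2) prime_gt_0_nat by blast
  then have "s dvd (\<Prod>i\<in>A. p i ^ (\<Sum>j=1..N i. e i j))"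
    using assms(4) order_cyclic_sum[OF assms(1)] by simp
  then obtain i where "i \<in> A" "s dvd p i ^ (\<Sum>j=1..N i. e i j)"
    using assms(1,3) by (auto simp: prime_dvd_prod_iff)
  then show ?thesis
    using primes_dvd_imp_eq[OF assms(3) assms(2), of i] prime_dvd_power[OF assms(3)] by blast
qed

subsection \<open>The bounds \<open>K1_star\<close> and \<open>k_star\<close>\<close>

text \<open>As a sum of the decreasing functions \<open>1 / x ^ j\<close>, the quotient is visibly
  antitone in \<open>x\<close>.\<close>

lemma geometric_quotient_eq_sum:
  fixes x :: real
  assumes "x > 1"
  shows "(x ^ k - 1) / (x ^ (k + 1) - x ^ k) = (\<Sum>j=1..k. 1 / x ^ j)"
proof (induction k)
  case (Suc k)
  have "(x ^ Suc k - 1) / (x ^ (Suc k + 1) - x ^ Suc k)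
      = (x ^ k - 1) / (x ^ (k + 1) - x ^ k) + 1 / x ^ Suc k"
    using assms by (simp add: field_simps)
  then show ?case using Suc.IH by simp
qed simp

text \<open>This compares the summand at \<open>p i\<close> with the one at its upper bound
  \<open>c * p 1\<close>.\<close>

lemma geometric_quotient_antimono:
  fixes x y :: real
  assumes "1 < x" "x \<le> y"
  shows "(y ^ k - 1) / (y ^ (k + 1) - y ^ k) \<le> (x ^ k - 1) / (x ^ (k + 1) - x ^ k)"
  using assms
  by (subst (1 2) geometric_quotient_eq_sum) (auto intro!: sum_mono frac_le power_mono)

text \<open>The gain of \<open>K1_star\<close> over \<open>k_star\<close> in one cyclic summand has
  the shape of the terms in \<open>c * p 1\<close> that occur in \<open>L\<close>.\<close>

lemma K1_star_summand_minus_k_star_summand: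
  fixes x :: real
  assumes "x > 1" "k \<ge> 1"
  shows "(x ^ k - 1) / (x ^ k - x ^ (k - 1)) - (x ^ k - 1) / x ^ k
      = (x ^ k - 1) / (x ^ (k + 1) - x ^ k)"
proof -
  obtain m where "k = Suc m" using assms(2) by (cases k) auto
  then show ?thesis using assms(1) by (simp add: field_simps)
qed

text \<open>The same quotient again: it identifies the \<open>K1_star\<close> term of
  \<open>L\<close> with the gain at index 1.\<close>

lemma K1_star_summand_divide:
  fixes x :: real
  assumes "x > 1" "k \<ge> 1"
  shows "1 / x * ((x ^ k - 1) / (x ^ k - x ^ (k - 1))) = (x ^ k - 1) / (x ^ (k + 1) - x ^ k)"
proof -
  obtain m where "k = Suc m" using assms(2) by (cases k) auto
  then show ?thesis using assms(1) by (simp add: field_simps)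
qed

lemma K1_star_minus_k_star:
  assumes "\<And>i. i \<in> A \<Longrightarrow> p i > 1" "\<And>i j. i \<in> A \<Longrightarrow> j \<in> {1..N i} \<Longrightarrow> e i j \<ge> 1"
  shows "K1_star A p N e - k_star A p N e
      = (\<Sum>i\<in>A. \<Sum>j=1..N i. (real (p i) ^ e i j - 1) / (real (p i) ^ (e i j + 1) - real (p i) ^ e i j))"
  unfolding K1_star_def k_star_def sum_subtractf[symmetric]
  using assms by (intro sum.cong refl K1_star_summand_minus_k_star_summand) auto

text \<open>The adjoined summand has exponent 1 and contributes \<open>(r - 1) / (r - 1)\<close>,
  which is 1 because \<open>r > 1\<close>.\<close>

lemma K1_star_adjoin:
  assumes "r > 1"
  shows "K1_star {0..n} (adjoin_p r p) (adjoin_N N) (adjoin_e e) = 1 + K1_star {1..n} p N e"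
proof -
  have "{0..n} = insert 0 {1..n}" by auto
  then show ?thesis using assms by (simp add: K1_star_def adjoin_p_def adjoin_N_def adjoin_e_def)
qed

lemma k_star_adjoin:
  "k_star {0..n} (adjoin_p r p) (adjoin_N N) (adjoin_e e)
    = (real r - 1) / real r + k_star {1..n} p N e"
proof -
  have "{0..n} = insert 0 {1..n}" by auto
  then show ?thesis by (simp add: k_star_def adjoin_p_def adjoin_N_def adjoin_e_def)
qed

section \<open>The theorem, by comparing the two sides of the hypothesis on the smallest
  prime\<close>

theorem theorem8:
  fixes c L R :: real and r n :: nat
    and p N :: "nat \<Rightarrow> nat" and e :: "nat \<Rightarrow> nat \<Rightarrow> nat"
    and G :: "(nat \<times> nat \<Rightarrow> int) monoid"
    and H :: "(int \<times> (nat \<times> nat \<Rightarrow> int)) monoid"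
  assumes c: "c \<ge> 1"
    and r: "r \<in> {2, 3}"
    and n: "n \<ge> 1"
    and N: "\<And>i. i \<in> {1..n} \<Longrightarrow> N i \<ge> 1"
    and e: "\<And>i j. i \<in> {1..n} \<Longrightarrow> j \<in> {1..N i} \<Longrightarrow> e i j \<ge> 1"
    and p: "\<And>i. i \<in> {1..n} \<Longrightarrow> prime (p i) \<and> p i > r"
    and p_mono: "strict_mono_on {1..n} p"
    and p_bound: "n > 1 \<Longrightarrow> real (p n) < c * real (p 1)"
    and G: "G = cyclic_sum {1..n} p N e"
    and H: "H = integer_mod_group r \<times>\<times> G"
    and K1_G: "K1 G = K1_star {1..n} p N e"
    and k_H: "little_k H = k_star {0..n} (adjoin_p r p) (adjoin_N N) (adjoin_e e)"
    and L: "L = 1 / real r + 1 / real (p 1) * K1_star {1} p N e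
        + (\<Sum>i=2..n. \<Sum>j=1..N i. ((c * real (p 1)) ^ e i j - 1)
             / ((c * real (p 1)) ^ (e i j + 1) - (c * real (p 1)) ^ e i j))"
    and R: "R = log 2 (real r * c ^ (\<Sum>i=2..n. \<Sum>j=1..N i. e i j)
        * real (p 1) ^ (\<Sum>i=1..n. \<Sum>j=1..N i. e i j)) / real (p 1)"
    and star: "L \<ge> R"
  shows "K1 H = K1_star {0..n} (adjoin_p r p) (adjoin_N N) (adjoin_e e) \<and>
    (L \<noteq> R \<longrightarrow>
      (\<forall>g I. ufim H (carrier H - {\<one>\<^bsub>H\<^esub>}) g I \<and> cross_number H g I = K1 H \<longrightarrow>
        (\<exists>A B. I = A \<union> B \<and> A \<inter> B = {} \<and>
           ufim H (carrier (integer_mod_group r) \<times> {\<one>\<^bsub>G\<^esub>} - {\<one>\<^bsub>H\<^esub>}) g A \<and>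
           ufim H ({\<one>\<^bsub>integer_mod_group r\<^esub>} \<times> carrier G - {\<one>\<^bsub>H\<^esub>}) g B)))"
proof -
  have r1: "r > 1" and prime_r: "prime r" using r by (auto simp: two_is_prime_nat)
  have p_prime: "prime (p i)" and p_gt: "p i > r" if "i \<in> {1..n}" for i using p that by auto
  have p_pos: "p i > 0" if "i \<in> {1..n}" for i using p_gt[OF that] by simp
  have p1: "real (p 1) > 1" using p_gt[of 1] n r1 by simp
  have p_ge: "p 1 \<le> p i" if "i \<in> {1..n}" for i
    using strict_mono_onD[OF p_mono, of 1 i] that by (cases "i = 1") auto
  \<comment> \<open>An index in \<open>{2..n}\<close> forces \<open>n > 1\<close>, so
    \<open>p_bound\<close> is available.\<close>
  have p_le: "real (p i) \<le> c * real (p 1)" if "i \<in> {2..n}" for i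
  proof -
    have "p i \<le> p n" using strict_mono_onD[OF p_mono, of i n] that by (cases "i = n") auto
    then show ?thesis using p_bound that by simp
  qed
  have split: "{1..n} = insert 1 {2..n}" using n by auto

  interpret comm_group G unfolding G by (rule comm_group_cyclic_sum) (use p_pos in auto)
  have fin: "finite (carrier G)" unfolding G by (rule finite_cyclic_sum) (use p_pos in auto)
  have prime_dvd: "\<exists>i\<in>{1..n}. s = p i" if "prime s" "s dvd order G" for s
    using prime_dvd_order_cyclic_sum[of "{1..n}" p s N e] p_prime that unfolding G by simp
  have "\<not> r dvd order G" using prime_dvd[OF prime_r] p_gt by fastforce
  then interpret cyclic_extension G r
    by unfold_locales (use r fin prime_r in \<open>auto intro: prime_imp_coprime\<close>)
  have H': "H = integer_mod_group r \<times>\<times> G" by (rule H)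
  \<comment> \<open>A prime factor of \<open>ord x\<close> divides \<open>order G\<close>, so it is
    some \<open>p i\<close>, and \<open>p 1\<close> is the least of these.\<close>
  have q: "\<forall>x\<in>carrier G - {\<one>\<^bsub>G\<^esub>}. p 1 \<le> ord x"
  proof
    fix x assume x: "x \<in> carrier G - {\<one>\<^bsub>G\<^esub>}"
    have "ord x \<noteq> 1" using x ord_eq_1[of x] by blast
    then obtain s where s: "prime s" "s dvd ord x" using prime_factor_nat by blast
    then obtain i where "i \<in> {1..n}" "s = p i"
      using prime_dvd dvd_trans[OF s(2) ord_dvd_group_order[of x]] x by blast
    then have "p 1 \<le> s" using p_ge by blast
    also have "s \<le> ord x" using s(2) ord_pos[of x] x by (auto intro: dvd_imp_le)
    finally show "p 1 \<le> ord x" .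
  qed

  \<comment> \<open>Replacing each \<open>p i\<close> with \<open>i\<close> at least 2 by
    \<open>c * p 1\<close> turns the group order into the argument of the logarithm in
    \<open>R\<close>.\<close>
  have order_le: "real (order H) \<le> real r * c ^ (\<Sum>i=2..n. \<Sum>j=1..N i. e i j)
        * real (p 1) ^ (\<Sum>i=1..n. \<Sum>j=1..N i. e i j)"
  proof -
    define s where "s i = (\<Sum>j=1..N i. e i j)" for i
    have "real (order H) = real r * (\<Prod>i=1..n. real (p i) ^ s i)"
      using order_cyclic_sum[of "{1..n}" p N e] p_pos unfolding H' order_H G[symmetric]
      by (simp add: s_def)
    also have "(\<Prod>i=1..n. real (p i) ^ s i) = real (p 1) ^ s 1 * (\<Prod>i=2..n. real (p i) ^ s i)"
      unfolding split by (subst prod.insert) auto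
    also have "(\<Prod>i=2..n. real (p i) ^ s i) \<le> (\<Prod>i=2..n. (c * real (p 1)) ^ s i)"
      by (rule prod_mono) (use p_le in \<open>auto intro!: power_mono\<close>)
    also have "\<dots> = c ^ (\<Sum>i=2..n. s i) * real (p 1) ^ (\<Sum>i=2..n. s i)"
      by (simp add: power_mult_distrib prod.distrib power_sum)
    also have "real r * (real (p 1) ^ s 1 * (c ^ (\<Sum>i=2..n. s i) * real (p 1) ^ (\<Sum>i=2..n. s i)))
        = real r * c ^ (\<Sum>i=2..n. s i) * real (p 1) ^ (\<Sum>i=1..n. s i)"
      unfolding split by (subst sum.insert) (auto simp: power_add)
    finally show ?thesis using r1 p1 by (simp add: s_def)
  qed
  have "order H > 0" unfolding H' using finite_carrier_H by (simp only: H.order_gt_0_iff_finite)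
  then have R_ge: "log 2 (real (order H)) / real (p 1) \<le> R"
    unfolding R using order_le p1 by (intro divide_right_mono) auto

  \<comment> \<open>The difference is split at index 1, since \<open>L\<close> keeps
    \<open>p 1\<close> exact there and replaces the other primes by \<open>c * p 1\<close>, which
    can only shrink their terms.\<close>
  have "K1_star {1..n} p N e - k_star {1..n} p N e
      = (\<Sum>i=1..n. \<Sum>j=1..N i. (real (p i) ^ e i j - 1) / (real (p i) ^ (e i j + 1) - real (p i) ^ e i j))"
    by (rule K1_star_minus_k_star) (use p_gt r1 e in \<open>auto intro: less_trans\<close>)
  also have "\<dots> = (\<Sum>j=1..N 1. (real (p 1) ^ e 1 j - 1) / (real (p 1) ^ (e 1 j + 1) - real (p 1) ^ e 1 j))
      + (\<Sum>i=2..n. \<Sum>j=1..N i. (real (p i) ^ e i j - 1) / (real (p i) ^ (e i j + 1) - real (p i) ^ e i j))"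
    unfolding split by (subst sum.insert) auto
  also have "(\<Sum>j=1..N 1. (real (p 1) ^ e 1 j - 1) / (real (p 1) ^ (e 1 j + 1) - real (p 1) ^ e 1 j))
      = 1 / real (p 1) * K1_star {1} p N e"
  proof -
    have "K1_star {1} p N e
        = (\<Sum>j=1..N 1. (real (p 1) ^ e 1 j - 1) / (real (p 1) ^ e 1 j - real (p 1) ^ (e 1 j - 1)))"
      by (simp add: K1_star_def)
    moreover have "e 1 j \<ge> 1" if "j \<in> {1..N 1}" for j using e[of 1 j] n that by simp
    ultimately show ?thesis
      by (simp only: sum_distrib_left) (intro sum.cong refl K1_star_summand_divide[symmetric] p1)
  qed
  finally have "K1_star {1..n} p N e - k_star {1..n} p N e = 1 / real (p 1) * K1_star {1} p N e
      + (\<Sum>i=2..n. \<Sum>j=1..N i. (real (p i) ^ e i j - 1) / (real (p i) ^ (e i j + 1) - real (p i) ^ e i j))" .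
  moreover have "(\<Sum>i=2..n. \<Sum>j=1..N i. ((c * real (p 1)) ^ e i j - 1)
        / ((c * real (p 1)) ^ (e i j + 1) - (c * real (p 1)) ^ e i j))
      \<le> (\<Sum>i=2..n. \<Sum>j=1..N i. (real (p i) ^ e i j - 1) / (real (p i) ^ (e i j + 1) - real (p i) ^ e i j))"
  proof (intro sum_mono geometric_quotient_antimono p_le)
    show "1 < real (p i)" if "i \<in> {2..n}" for i using p_gt[of i] r1 that by simp
  qed
  ultimately have "K1_star {1..n} p N e - k_star {1..n} p N e \<ge> L - 1 / real r"
    unfolding L by simp
  \<comment> \<open>The adjoined summand gives \<open>(r - 1) / r\<close> in \<open>k_star\<close>,
    and the \<open>1 / r\<close> in \<open>L\<close> completes it to 1.\<close>
  then have main: "little_k H + L \<le> 1 + K1 G"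
    unfolding k_H K1_G k_star_adjoin using r1 by (simp add: field_simps)

  note cases = ufim_cross_number_cases[folded H', consumes 3, case_names no_C_block C_block]
  have q_pos: "p 1 > 0" using p1 by simp
  have upper: "cross_number H g I \<le> 1 + K1 G" if "ufim H (carrier H - {\<one>\<^bsub>H\<^esub>}) g I" for g I
    using that q_pos q
  proof (cases rule: cases)
    \<comment> \<open>The case of a block in the cyclic factor has the bound among its
      assumptions.\<close>
    case no_C_block
    then show ?thesis using R_ge star main by linarith
  qed
  obtain g I where "ufim H (carrier H - {\<one>\<^bsub>H\<^esub>}) g I" "cross_number H g I = K1 H"
    unfolding H' using H.K1_attained[OF finite_carrier_H] by blast
  then have K1_H: "K1 H = 1 + K1 G" using upper K1_ge[folded H'] by fastforce
  have "\<exists>A B. I = A \<union> B \<and> A \<inter> B = {} \<and>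
      ufim H (carrier (integer_mod_group r) \<times> {\<one>\<^bsub>G\<^esub>} - {\<one>\<^bsub>H\<^esub>}) g A \<and>
      ufim H ({\<one>\<^bsub>integer_mod_group r\<^esub>} \<times> carrier G - {\<one>\<^bsub>H\<^esub>}) g B"
    if "L \<noteq> R" and "ufim H (carrier H - {\<one>\<^bsub>H\<^esub>}) g I" "cross_number H g I = K1 H" for g I
    using that(2) q_pos q
  proof (cases rule: cases)
    \<comment> \<open>Here \<open>R < L\<close>, so the cross number would be strictly below
      \<open>1 + K1 G\<close>, against its maximality.\<close>
    case no_C_block
    then show ?thesis using R_ge star main K1_H that(1,3) by linarith
  next
    case (C_block T)
    then show ?thesis using K1_H that(3) by (intro exI[of _ T] exI[of _ "I - T"]) auto
  qed
  moreover have "K1 H = K1_star {0..n} (adjoin_p r p) (adjoin_N N) (adjoin_e e)"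
    using K1_H K1_G K1_star_adjoin[OF r1] by simp
  ultimately show ?thesis by blast
qed

end
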